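(* Let $p\ge 1$, let $\{Z_t\}_{t\in\mathbb Z}$ be i.i.d. real random variables with $\mathbb E(Z_0)=0$, $\mathbb E(Z_0^2)=1$, and let $a_0,\dots,a_p:(0,1]\to[0,\infty)$. For each $N$ let $\{X_{t,N}\}_{t\le N}$ satisfy $X_{t,N}=Z_t\sigma_{t,N}$, $\sigma_{t,N}^2=a_0(t/N)+\sum_{j=1}^p a_j(t/N)X_{t-j,N}^2$, and for $u\in(0,1]$ let $\{X_t(u)\}_t$ be the stationary process satisfying $X_t(u)=Z_t\sigma_t(u)$, $\sigma_t(u)^2=a_0(u)+\sum_{j=1}^p a_j(u)X_{t-j}(u)^2$. Suppose Assumption A$(r)$ (see context) holds with some $r>4$. Let $\hat{\underline a}_{t,N}$ be the ANRE estimator with step size $\lambda=\lambda_N$, where $\lambda_N\to 0$ and $N\lambda_N\gg(\log N)^{1+\varepsilon}$ for some $\varepsilon>0$. Let $u_0\in(0,1]$ and let $t_0=t_0(N)$ satisfy $|u_0-t_0/N|<1/N$. Then $$\mathbb E\{|\hat{\underline a}_{t_0,N}-\underline a(u_0)|^2\}=O\Big(\lambda+\frac{1}{(N\lambda)^{2\beta}}\Big).$$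
   Context: Notation: $|x|_1=\sum_i|x_i|$, $|\cdot|$ is the Euclidean norm. $\mathcal X_{t,N}=(1,X_{t,N}^2,\dots,X_{t-p+1,N}^2)^\top$, $\underline a(u)=(a_0(u),\dots,a_p(u))^\top$. The ANRE algorithm: $\hat{\underline a}_{p,N}=0$ and for $t=p+1,\dots,N$, $\hat{\underline a}_{t,N}=\hat{\underline a}_{t-1,N}+\lambda\{X_{t,N}^2-\hat{\underline a}_{t-1,N}^\top\mathcal X_{t-1,N}\}\mathcal X_{t-1,N}/|\mathcal X_{t-1,N}|_1^2$. Assumption A$(r)$: (i) there is $\eta>0$ with $\{\mathbb E(Z_0^{2r})\}^{1/r}\sup_u\sum_{j=1}^p a_j(u)<1-\eta$; (ii) there are $0<\rho_1\le\rho_2<\infty$ with $\rho_1\le a_0(u)\le\rho_2$ for all $u\in(0,1]$; (iii) there are $\beta\in(0,1]$ and $K$ with $|a_j(u)-a_j(v)|\le K|u-v|^\beta$ for all $u,v\in(0,1]$, $j=0,\dots,p$; (iv) with $Y_0(u)=a_0(u)Z_0^2$, $Y_t(u)=\{a_0(u)+\sum_{j=1}^t a_j(u)Y_{t-j}(u)\}Z_t^2$ ($t=1,\dots,p$), $\underline Y_p(u)=(1,Y_1(u),\dots,Y_p(u))^\top$, there is $C>0$ with $\inf_u\lambda_{\min}\{\mathbb E(\underline Y_p(u)\underline Y_p(u)^\top)\}\ge C$. The notation $a_N\gg b_N$ means $b_N/a_N\to0$.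
   Formalization: X_{t,N} is taken to be a causal solution (measurable in Z_s, s≤t) with sup over t≤N of E X_{t,N}^2 finite for each N, and a_j(t/N) for t≤0 is read as the limit of a_j at 0+; without this the recursion is undefined for t≤0 and admits explosive solutions. *)

theory Defs
  imports "HOL-Probability.Probability" "HOL-Library.Landau_Symbols"
    "Jordan_Normal_Form.Char_Poly"
begin

definition lambda_min :: "real mat \<Rightarrow> real" where
  "lambda_min A = Min {e. eigenvalue A e}"

text \<open>Coefficient functions a_j, defined on (0,1]; for times t \<le> 0 (i.e. u \<le> 0)
  the coefficient is taken to be the value at the left end point, a_j(0) := lim_{v\<rightarrow>0+} a_j(v).\<close>
definition coef :: "(nat \<Rightarrow> real \<Rightarrow> real) \<Rightarrow> nat \<Rightarrow> real \<Rightarrow> real" where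
  "coef a j u = (if u \<le> 0 then Lim (at_right 0) (a j) else a j u)"

fun Yrec :: "(nat \<Rightarrow> real \<Rightarrow> real) \<Rightarrow> (int \<Rightarrow> 'a \<Rightarrow> real) \<Rightarrow> real \<Rightarrow> nat \<Rightarrow> 'a \<Rightarrow> real" where
  "Yrec a Z u 0 \<omega> = a 0 u * (Z 0 \<omega>)\<^sup>2"
| "Yrec a Z u (Suc t) \<omega> =
     (a 0 u + (\<Sum>j\<in>{1..Suc t}. a j u * Yrec a Z u (Suc t - j) \<omega>)) * (Z (int (Suc t)) \<omega>)\<^sup>2"

definition Yvec :: "(nat \<Rightarrow> real \<Rightarrow> real) \<Rightarrow> (int \<Rightarrow> 'a \<Rightarrow> real) \<Rightarrow> real \<Rightarrow> nat \<Rightarrow> 'a \<Rightarrow> real" where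
  "Yvec a Z u i \<omega> = (if i = 0 then 1 else Yrec a Z u i \<omega>)"

definition Ymoment :: "'a measure \<Rightarrow> nat \<Rightarrow> (nat \<Rightarrow> real \<Rightarrow> real) \<Rightarrow> (int \<Rightarrow> 'a \<Rightarrow> real) \<Rightarrow> real \<Rightarrow> real mat" where
  "Ymoment M p a Z u = mat (p+1) (p+1)
     (\<lambda>(i,j). integral\<^sup>L M (\<lambda>\<omega>. Yvec a Z u i \<omega> * Yvec a Z u j \<omega>))"

definition calX :: "nat \<Rightarrow> (int \<Rightarrow> real) \<Rightarrow> nat \<Rightarrow> nat \<Rightarrow> real" where
  "calX p x t i = (if i = 0 then 1 else if i \<le> p then (x (int t - int i + 1))\<^sup>2 else 0)"

definition norm1 :: "nat \<Rightarrow> (nat \<Rightarrow> real) \<Rightarrow> real" where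
  "norm1 p v = (\<Sum>i\<le>p. \<bar>v i\<bar>)"

fun anre :: "real \<Rightarrow> nat \<Rightarrow> (int \<Rightarrow> real) \<Rightarrow> nat \<Rightarrow> nat \<Rightarrow> real" where
  "anre lam p x 0 = (\<lambda>_. 0)"
| "anre lam p x (Suc t) =
     (if Suc t \<le> p then (\<lambda>_. 0)
      else (\<lambda>i. anre lam p x t i
               + lam * ((x (int (Suc t)))\<^sup>2 - (\<Sum>k\<le>p. anre lam p x t k * calX p x t k))
                   * calX p x t i / (norm1 p (calX p x t))\<^sup>2))"

end

theory Submission
  imports Defs "HOL-Real_Asymp.Real_Asymp"
begin

text \<open>
  Write \<open>v\<close> for the estimation error, \<open>y\<close> for the regressor \<open>(1, X_t^2, ..., X_{t-p+1}^2)\<close>, \<open>D\<close> for its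
  \<open>l^1\<close>-norm and \<open>l\<close> for the step size. One step of the algorithm is the rank-one update
  \<open>v' = v + l c y/D\<close> with \<open>c = -(v.y)/D + (Z^2 - 1) s/D + bias\<close>, where \<open>s/D\<close> is bounded and the bias is
  \<open>O(|t/N - u0|^\<beta>)\<close>. The decrease \<open>l ((v.y)/D)^2\<close> of \<open>|v|^2\<close> sees only one direction, so \<open>|v|^2\<close> is replaced by
    \<open>|v|^2 (1 + l \<mu> V(y)) - l \<Sum>_{k=1..p} \<kappa>^{k-1} (h_k/D)^2\<close>,  \<open>h_k = v_0 + v_k y_1 + ... + v_p y_{p-k+1}\<close>.
  After a step \<open>h_k' = v_k s Z^2 + h_{k+1}\<close>. As \<open>Z^2\<close> is not constant (otherwise the moment matrix in A(r)(iv) would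
  be singular), the conditional mean of \<open>(h_k'/D')^2\<close> is at least \<open>\<kappa> (v_k^2 + h_{k+1}^2)/D^2\<close>: the sum telescopes
  and leaves a decrease \<open>const l |v|^2/D^2\<close>. The linear functional \<open>V\<close> has negative drift where \<open>D\<close> is large,
  which makes the decrease uniform. Hence the expectation \<open>E_t\<close> of the Lyapunov function satisfies
    \<open>E_{t+1} \<le> (1 - c l) E_t + 2 l bias^2 + O(l^2)\<close>,
  and iterating this gives the claim.
\<close>

section \<open>The Lyapunov function\<close>

text \<open>The error and the regressor are dependent and \<open>D\<close> is unbounded: the gain
  \<open>l |v|^2/D^2\<close> fades for large \<open>D\<close>, while the second-order loss has size
  \<open>l^2 (1 + |v|^2) D\<close>. No factor can be moved out of the expectation, so the weight
  \<open>1 + l \<mu> V(y)\<close> has to repair both defects. The coefficients sum to less than 1,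
  hence \<open>l \<mu> |v|^2 V\<close> loses a multiple of \<open>l |v|^2 D\<close> per step, up to
  a constant that the gain \<open>l |v|^2/D^2\<close> covers on bounded \<open>D\<close>. What
  remains is a loss \<open>l^2 D\<close>, whose mean is controlled by the second moments of the
  process. The form \<open>h_k\<close> is the part of \<open>v.y_{t+k-1}\<close> that is known at
  time \<open>t\<close> when \<open>v\<close> is frozen; \<open>h_1\<close> is \<open>v.y\<close>
  and \<open>h_{p+1}\<close> is \<open>v_0\<close>. Thus the excitation of all \<open>p+1\<close>
  directions, which would otherwise need a block of steps, is read off from a single step. Both
  corrections carry a factor \<open>l\<close>; the subtracted one is at most half of
  \<open>|v|^2\<close>. All expectations are extended nonnegative integrals, so finiteness of the
  mean squared error comes out of the recursion instead of being presupposed.\<close>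

definition tail_form :: "nat \<Rightarrow> nat \<Rightarrow> (nat \<Rightarrow> real) \<Rightarrow> (nat \<Rightarrow> real) \<Rightarrow> real" where
  "tail_form p k v y = v 0 + (\<Sum>i\<in>{k..p}. v i * y (Suc i - k))"

text \<open>The value 0 beyond \<open>p\<close> agrees with \<open>calX\<close>, so that
  \<open>regr_Suc\<close> is an identity of functions.\<close>

definition shift_in :: "nat \<Rightarrow> real \<Rightarrow> (nat \<Rightarrow> real) \<Rightarrow> nat \<Rightarrow> real" where
  "shift_in p x y i = (if i = 0 then 1 else if i = 1 then x else if i \<le> p then y (i - 1) else 0)"

definition sq_norm :: "nat \<Rightarrow> (nat \<Rightarrow> real) \<Rightarrow> real" where
  "sq_norm p v = (\<Sum>i\<le>p. (v i)\<^sup>2)"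

definition wsum :: "nat \<Rightarrow> (nat \<Rightarrow> real) \<Rightarrow> (nat \<Rightarrow> real) \<Rightarrow> real" where
  "wsum p w y = (\<Sum>i\<in>{1..p}. w i * y i)"

definition lyap :: "nat \<Rightarrow> real \<Rightarrow> real \<Rightarrow> real \<Rightarrow> (nat \<Rightarrow> real) \<Rightarrow> (nat \<Rightarrow> real) \<Rightarrow> (nat \<Rightarrow> real) \<Rightarrow> real" where
  "lyap p \<kappa> \<mu> l w v y = sq_norm p v * (1 + l * \<mu> * wsum p w y)
     - l * (\<Sum>k\<in>{1..p}. \<kappa> ^ (k - 1) * (tail_form p k v y / norm1 p y)\<^sup>2)"

text \<open>One step of the algorithm, written for the error \<open>v\<close> of the estimate \<open>v + \<alpha>\<close>.\<close>

definition nlms :: "nat \<Rightarrow> real \<Rightarrow> (nat \<Rightarrow> real) \<Rightarrow> (nat \<Rightarrow> real) \<Rightarrow> (nat \<Rightarrow> real) \<Rightarrow> real \<Rightarrow> nat \<Rightarrow> real" where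
  "nlms p l \<alpha> v y x i = v i + l * (x - (\<Sum>k\<le>p. (v k + \<alpha> k) * y k)) * y i / (norm1 p y)\<^sup>2"

section \<open>Bounds for the forms, the shift and the regressor norm\<close>

lemma atMost_split: "(\<Sum>i\<le>p. f i) = f 0 + (\<Sum>i\<in>{1..p}. f i)" for f :: "nat \<Rightarrow> real"
  by (simp add: atMost_atLeast0 sum.atLeast_Suc_atMost)

lemma sq_norm_nonneg: "0 \<le> sq_norm p v"
  unfolding sq_norm_def by (rule sum_nonneg) simp

lemma abs_le_sqrt_sq_norm: "i \<le> p \<Longrightarrow> \<bar>v i\<bar> \<le> sqrt (sq_norm p v)"
proof (rule real_le_rsqrt)
  assume "i \<le> p"
  then show "\<bar>v i\<bar>\<^sup>2 \<le> sq_norm p v"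
    unfolding sq_norm_def by (intro order_trans[OF _ member_le_sum[of i]]) auto
qed

lemma norm1_nonneg_eq: "(\<And>i. i \<le> p \<Longrightarrow> 0 \<le> y i) \<Longrightarrow> norm1 p y = (\<Sum>i\<le>p. y i)"
  unfolding norm1_def by (rule sum.cong) auto

lemma tail_form_1: "y 0 = 1 \<Longrightarrow> tail_form p 1 v y = (\<Sum>i\<le>p. v i * y i)"
  unfolding tail_form_def by (simp add: atMost_split)

lemma tail_form_end: "tail_form p (Suc p) v y = v 0"
  unfolding tail_form_def by simp

lemma tail_form_shift_in:
  assumes "k \<in> {1..p}"
  shows "tail_form p k v (shift_in p x y) = v k * x + tail_form p (Suc k) v y"
proof -
  have "(\<Sum>i\<in>{Suc k..p}. v i * shift_in p x y (Suc i - k)) = (\<Sum>i\<in>{Suc k..p}. v i * y (Suc i - Suc k))"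
    using assms by (intro sum.cong) (auto simp: shift_in_def)
  with assms show ?thesis
    unfolding tail_form_def by (simp add: sum.atLeast_Suc_atMost shift_in_def)
qed

lemma tail_form_add: "tail_form p k (\<lambda>i. v i + c * u i) y = tail_form p k v y + c * tail_form p k u y"
  unfolding tail_form_def by (simp add: algebra_simps sum.distrib sum_distrib_left)

text \<open>Since \<open>k\<close> is positive, the entries of \<open>y\<close> in the form are
  distinct and exclude the leading 1, which is matched with \<open>v 0\<close>. So a sup bound on
  \<open>v\<close> pairs with the \<open>l^1\<close> norm of \<open>y\<close>.\<close>

lemma abs_tail_form_le:
  assumes "y 0 = 1" "\<And>i. i \<le> p \<Longrightarrow> 0 \<le> y i" "\<And>i. i \<le> p \<Longrightarrow> \<bar>v i\<bar> \<le> n" "k \<ge> 1"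
  shows "\<bar>tail_form p k v y\<bar> \<le> n * norm1 p y"
proof -
  have n: "0 \<le> n" using assms(3)[of 0] by simp
  have "(\<Sum>i\<in>{k..p}. y (Suc i - k)) = sum y ((\<lambda>i. Suc i - k) ` {k..p})"
    by (subst sum.reindex) (auto simp: inj_on_def)
  also have "\<dots> \<le> sum y {1..p}"
    using assms by (intro sum_mono2) auto
  finally have *: "(\<Sum>i\<in>{k..p}. y (Suc i - k)) \<le> sum y {1..p}" .
  have "\<bar>tail_form p k v y\<bar> \<le> \<bar>v 0\<bar> + \<bar>\<Sum>i\<in>{k..p}. v i * y (Suc i - k)\<bar>"
    unfolding tail_form_def by (rule abs_triangle_ineq)
  also have "\<dots> \<le> n + (\<Sum>i\<in>{k..p}. n * y (Suc i - k))"
    using assms by (intro add_mono order_trans[OF sum_abs] sum_mono)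
       (auto simp: abs_mult intro!: mult_mono n)
  also have "\<dots> = n * (1 + (\<Sum>i\<in>{k..p}. y (Suc i - k)))"
    by (simp add: sum_distrib_left algebra_simps)
  also have "\<dots> \<le> n * (1 + sum y {1..p})"
    using * n by (intro mult_left_mono) auto
  also have "\<dots> = n * norm1 p y"
    using assms by (simp add: norm1_nonneg_eq atMost_split)
  finally show ?thesis .
qed

lemma norm1_ge_1:
  assumes "y 0 = 1" shows "1 \<le> norm1 p y"
  using assms unfolding norm1_def atMost_split by (auto intro: sum_nonneg)

lemma shift_in_nonneg:
  assumes "\<And>i. i \<le> p \<Longrightarrow> 0 \<le> y i" "0 \<le> x"
  shows "0 \<le> shift_in p x y i"
  using assms by (auto simp: shift_in_def)

lemma sum_shift_in:
  assumes "p \<ge> 1"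
  shows "(\<Sum>i\<in>{1..p}. f i * shift_in p x y i) = f 1 * x + (\<Sum>i\<in>{1..<p}. f (Suc i) * y i)"
proof -
  have "(\<Sum>i\<in>{1..p}. f i * shift_in p x y i) = f 1 * x + (\<Sum>i\<in>{Suc 1..p}. f i * shift_in p x y i)"
    using assms by (simp add: sum.atLeast_Suc_atMost shift_in_def)
  also have "(\<Sum>i\<in>{Suc 1..p}. f i * shift_in p x y i) = (\<Sum>i\<in>{Suc 1..p}. f i * y (i - 1))"
    by (intro sum.cong) (auto simp: shift_in_def)
  also have "\<dots> = (\<Sum>i\<in>{1..<p}. f (Suc i) * y i)"
    by (rule sum.reindex_bij_witness[of _ Suc "\<lambda>i. i - 1"]) auto
  finally show ?thesis .
qed

lemma norm1_shift_in_le: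
  assumes "p \<ge> 1" "y 0 = 1" "\<And>i. i \<le> p \<Longrightarrow> 0 \<le> y i" "0 \<le> x"
  shows "norm1 p (shift_in p x y) \<le> norm1 p y + x"
proof -
  have "norm1 p (shift_in p x y) = 1 + (\<Sum>i\<in>{1..p}. 1 * shift_in p x y i)"
    using assms by (simp add: norm1_nonneg_eq shift_in_nonneg atMost_split) (simp add: shift_in_def)
  also have "\<dots> = 1 + x + (\<Sum>i\<in>{1..<p}. y i)"
    unfolding sum_shift_in[OF assms(1)] by simp
  also have "\<dots> \<le> 1 + x + (\<Sum>i\<in>{1..p}. y i)"
    using assms by (intro add_left_mono sum_mono2) auto
  also have "\<dots> = norm1 p y + x"
    using assms by (simp add: norm1_nonneg_eq atMost_split)
  finally show ?thesis .
qed

text \<open>A pathwise estimate: \<open>q\<close> stands for the squared noise and \<open>s\<close>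
  for the conditional variance. The factors in \<open>q\<close> stay explicit, so that
  \<open>lyap_drift\<close> only has to integrate them. The terms of first order in \<open>l\<close>
  are displayed separately; the rest is collected in one remainder of order
  \<open>l^2\<close>.\<close>

lemma lyap_rank_one_step:
  fixes p :: nat and l q s b A Bm B \<mu> \<kappa> :: real and v y w' :: "nat \<Rightarrow> real"
  defines "D \<equiv> norm1 p y"
  defines "S \<equiv> sq_norm p v"
  defines "g \<equiv> tail_form p 1 v y / D"
  defines "c \<equiv> (q - 1) * (s / D) + b - g"
  assumes p: "p \<ge> 1" and y: "y 0 = 1" "\<And>i. i \<le> p \<Longrightarrow> 0 \<le> y i"
    and l: "0 \<le> l" "l \<le> 1" and mu: "0 \<le> \<mu>" "\<mu> \<le> 1" and kap: "0 \<le> \<kappa>" "\<kappa> \<le> 1"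
    and q: "0 \<le> q" and A: "1 \<le> A" and s: "0 \<le> s" "s \<le> A * D"
    and b: "\<bar>b\<bar> \<le> B" "B \<le> Bm"
    and w': "w' 1 = 1" "\<And>i. i \<in> {1..p} \<Longrightarrow> 0 \<le> w' i \<and> w' i \<le> 1"
  shows "lyap p \<kappa> \<mu> l w' (\<lambda>i. v i + l * c * (y i / D)) (shift_in p (s * q) y) \<le>
      S - 3/2 * l * g\<^sup>2 + 2 * l * B\<^sup>2 + 2 * l * (s / D) * g * (q - 1)
      + l * \<mu> * S * (s * q + (\<Sum>i\<in>{1..<p}. w' (Suc i) * y i))
      + l\<^sup>2 * ((7 + 4 * p) * (1 + A\<^sup>2 + Bm\<^sup>2) * (1 + S) * D) * ((1 + (q - 1)\<^sup>2) * (1 + A * q))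
      - l * (\<Sum>k\<in>{1..p}. \<kappa> ^ (k - 1) * ((v k * s * q + tail_form p (Suc k) v y)\<^sup>2 / (1 + A * q)\<^sup>2 / D\<^sup>2))"
proof -
  define v' where "v' = (\<lambda>i. v i + l * c * (y i / D))"
  define y' where "y' = shift_in p (s * q) y"
  define D' where "D' = norm1 p y'"
  define \<zeta> where "\<zeta> = q - 1"
  define \<sigma> where "\<sigma> = s / D"
  define C0 where "C0 = 1 + A\<^sup>2 + Bm\<^sup>2"
  \<comment> \<open>A single quantity above \<open>S\<close>, the squared noise term and the squared
    bias; \<open>c^2\<close> and all second-order errors are bounded by multiples of it.\<close>
  define E where "E = C0 * (1 + S) * (1 + \<zeta>\<^sup>2)"
  have D1: "1 \<le> D" unfolding D_def using y(1) by (rule norm1_ge_1)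
  have S0: "0 \<le> S" unfolding S_def by (rule sq_norm_nonneg)
  have sig: "0 \<le> \<sigma>" "\<sigma> \<le> A" using D1 s by (auto simp: \<sigma>_def field_simps)
  have c_eq: "c = \<zeta> * \<sigma> + b - g" by (simp add: c_def \<zeta>_def \<sigma>_def)
  have vS: "\<bar>v i\<bar> \<le> sqrt S" if "i \<le> p" for i unfolding S_def using that by (rule abs_le_sqrt_sq_norm)
  have Dsum: "D = (\<Sum>i\<le>p. y i)" unfolding D_def using y(2) by (rule norm1_nonneg_eq)
  have G: "0 \<le> y i / D \<and> y i / D \<le> 1" if "i \<le> p" for i
  proof -
    have "y i \<le> D" unfolding Dsum using that y(2) by (intro member_le_sum) auto
    then show ?thesis using D1 y(2) that by simp
  qed
  have "\<bar>tail_form p 1 v y\<bar> \<le> sqrt S * D" unfolding D_def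
    by (rule abs_tail_form_le) (use y vS in auto)
  then have "\<bar>g\<bar> \<le> sqrt S" using D1 by (simp add: g_def field_simps)
  then have g2: "g\<^sup>2 \<le> S" using S0 by (metis abs_le_square_iff abs_of_nonneg real_sqrt_ge_0_iff real_sqrt_pow2)
  have bB: "b\<^sup>2 \<le> B\<^sup>2" using b by (metis abs_ge_zero abs_le_square_iff abs_of_nonneg order_trans)
  have B2: "B\<^sup>2 \<le> Bm\<^sup>2" using b by (intro power_mono) auto
  have sz2: "(\<zeta> * \<sigma>)\<^sup>2 \<le> A\<^sup>2 * \<zeta>\<^sup>2"
    unfolding power_mult_distrib mult.commute[of "\<zeta>\<^sup>2"]
    using sig by (intro mult_right_mono power_mono) auto
  have base: "S + A\<^sup>2 * \<zeta>\<^sup>2 + Bm\<^sup>2 \<le> E"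
  proof -
    have "0 \<le> A\<^sup>2 * S" "0 \<le> Bm\<^sup>2 * S" "0 \<le> S * \<zeta>\<^sup>2" "0 \<le> A\<^sup>2 * S * \<zeta>\<^sup>2" "0 \<le> Bm\<^sup>2 * S * \<zeta>\<^sup>2" "0 \<le> Bm\<^sup>2 * \<zeta>\<^sup>2" "0 \<le> A\<^sup>2" "0 \<le> \<zeta>\<^sup>2"
      using S0 by auto
    moreover have "E = (1 + A\<^sup>2 + Bm\<^sup>2) + S + A\<^sup>2 * S + Bm\<^sup>2 * S + \<zeta>\<^sup>2 + A\<^sup>2*\<zeta>\<^sup>2 + Bm\<^sup>2 * \<zeta>\<^sup>2 + S * \<zeta>\<^sup>2 + A\<^sup>2 * S * \<zeta>\<^sup>2 + Bm\<^sup>2 * S * \<zeta>\<^sup>2"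
      unfolding E_def C0_def by (simp add: algebra_simps)
    ultimately show ?thesis by linarith
  qed
  have E0: "0 \<le> E" using base S0 by (meson add_nonneg_nonneg mult_nonneg_nonneg order_trans zero_le_power2)
  have c2: "c\<^sup>2 \<le> 3 * E"
  proof -
    have "c\<^sup>2 \<le> 3 * ((\<zeta> * \<sigma>)\<^sup>2 + b\<^sup>2 + g\<^sup>2)"
    proof -
      have "0 \<le> (\<zeta>*\<sigma> - b)\<^sup>2 + (\<zeta>*\<sigma> + g)\<^sup>2 + (b + g)\<^sup>2" by simp
      then show ?thesis unfolding c_eq by (simp add: power2_eq_square algebra_simps)
    qed
    also have "\<dots> \<le> 3 * E"
      using add_mono[OF add_mono[OF sz2 order_trans[OF bB B2]] g2] base by (intro mult_left_mono) simp_all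
    finally show ?thesis .
  qed
  have "(\<Sum>i\<le>p. (y i / D)\<^sup>2) \<le> (\<Sum>i\<le>p. y i / D)"
    unfolding power2_eq_square by (intro sum_mono mult_left_le) (use G in auto)
  also have "\<dots> = 1" using D1 by (simp add: Dsum flip: sum_divide_distrib)
  finally have m1: "(\<Sum>i\<le>p. (y i / D)\<^sup>2) \<le> 1" .
  have gsum: "(\<Sum>i\<le>p. v i * (y i / D)) = g"
    by (simp only: g_def tail_form_1[where y = y, OF y(1)]) (simp add: sum_divide_distrib)
  have "sq_norm p v' = (\<Sum>i\<le>p. (v i)\<^sup>2 + 2 * (l * c) * (v i * (y i / D)) + (l * c)\<^sup>2 * (y i / D)\<^sup>2)"
    unfolding sq_norm_def v'_def by (intro sum.cong) (simp_all add: power2_eq_square algebra_simps)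
  also have "\<dots> = S + 2 * (l * c) * g + (l * c)\<^sup>2 * (\<Sum>i\<le>p. (y i / D)\<^sup>2)"
    by (simp only: sum.distrib S_def sq_norm_def gsum[symmetric] sum_distrib_left)
  also have "(l * c)\<^sup>2 * (\<Sum>i\<le>p. (y i / D)\<^sup>2) \<le> (l * c)\<^sup>2 * 1"
    using m1 by (intro mult_left_mono) auto
  finally have norm1: "sq_norm p v' \<le> S + l * (2 * c * g) + l\<^sup>2 * c\<^sup>2"
    by (simp add: power_mult_distrib algebra_simps)
  have lc: "l\<^sup>2 * c\<^sup>2 \<le> l\<^sup>2 * (3 * E)" using c2 by (intro mult_left_mono) auto
  \<comment> \<open>The bias is charged to only a quarter of the gain \<open>2 g^2\<close>. Of the
    surviving \<open>3/2 g^2\<close>, one \<open>g^2\<close> later pays for the telescoped tail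
    forms.\<close>
  have "2 * c * g \<le> - (3/2) * g\<^sup>2 + 2 * B\<^sup>2 + 2 * \<zeta> * \<sigma> * g"
  proof -
    have "0 \<le> (2 * b - g)\<^sup>2" by simp
    then have "2 * b * g \<le> 2 * b\<^sup>2 + g\<^sup>2 / 2" by (simp add: power2_eq_square algebra_simps)
    moreover have "2 * c * g = 2 * \<zeta> * \<sigma> * g + 2 * b * g - 2 * g\<^sup>2"
      unfolding c_eq by (simp add: power2_eq_square algebra_simps)
    ultimately show ?thesis using bB by linarith
  qed
  then have "l * (2 * c * g) \<le> l * (- (3/2) * g\<^sup>2 + 2 * B\<^sup>2 + 2 * \<zeta> * \<sigma> * g)"
    using l by (intro mult_left_mono) auto
  with norm1 lc have T1: "sq_norm p v' \<le> S - 3/2 * l * g\<^sup>2 + 2 * l * B\<^sup>2 + 2 * l * \<sigma> * g * \<zeta> + l\<^sup>2 * (3 * E)"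
    by (simp add: algebra_simps)
  \<comment> \<open>A cruder bound on the increment is enough for the product with
    \<open>wsum p w' y'\<close>, which already carries a factor \<open>l\<close>.\<close>
  have "2 * c * g \<le> E"
  proof -
    have "0 \<le> (2 * g - (\<zeta> * \<sigma> + b))\<^sup>2" "0 \<le> (\<zeta> * \<sigma> - b)\<^sup>2" by simp_all
    then have "2 * c * g \<le> (\<zeta> * \<sigma>)\<^sup>2 + b\<^sup>2" unfolding c_eq by (simp add: power2_eq_square algebra_simps)
    also have "\<dots> \<le> E" using add_mono[OF sz2 order_trans[OF bB B2]] base S0 by simp
    finally show ?thesis .
  qed
  then have "l * (2 * c * g) \<le> l * E" using l by (intro mult_left_mono) auto
  moreover have "l\<^sup>2 * (3 * E) \<le> l * (3 * E)"
    using l E0 by (intro mult_right_mono) (auto simp: power2_eq_square mult_left_le)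
  ultimately have T2a: "sq_norm p v' \<le> S + 4 * l * E" using norm1 lc by linarith
  have y'0: "y' 0 = 1" by (simp add: y'_def shift_in_def)
  have y'nn: "0 \<le> y' i" if "i \<le> p" for i
    unfolding y'_def using y q s by (intro shift_in_nonneg) auto
  have D'1: "1 \<le> D'" unfolding D'_def using y'0 by (rule norm1_ge_1)
  have D'D: "D' \<le> D * (1 + A * q)"
  proof -
    have "D' \<le> D + s * q" unfolding D'_def y'_def D_def
      using p y q s by (intro norm1_shift_in_le) auto
    also have "s * q \<le> A * D * q" using s q by (intro mult_right_mono) auto
    finally show ?thesis by (simp add: algebra_simps)
  qed
  have V'eq: "wsum p w' y' = s * q + (\<Sum>i\<in>{1..<p}. w' (Suc i) * y i)"
    unfolding wsum_def y'_def sum_shift_in[OF p] w'(1) by simp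
  have V'nn: "0 \<le> wsum p w' y'" unfolding wsum_def using w' y'nn by (intro sum_nonneg) auto
  have "wsum p w' y' \<le> (\<Sum>i\<in>{1..p}. y' i)"
    unfolding wsum_def using w' y'nn by (intro sum_mono) (auto intro!: mult_left_le_one_le)
  also have "\<dots> \<le> D'" unfolding D'_def using y'nn y'0 by (simp add: norm1_nonneg_eq atMost_split)
  finally have V'D: "wsum p w' y' \<le> D * (1 + A * q)" using D'D by linarith
  have "l * \<mu> * wsum p w' y' * sq_norm p v' \<le> l * \<mu> * wsum p w' y' * (S + 4 * l * E)"
    using T2a V'nn l mu by (intro mult_left_mono) auto
  also have "\<dots> = l * \<mu> * S * wsum p w' y' + 4 * l\<^sup>2 * E * (\<mu> * wsum p w' y')"
    by (simp add: power2_eq_square algebra_simps)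
  also have "\<mu> * wsum p w' y' \<le> 1 * (D * (1 + A * q))"
    using V'D V'nn mu by (intro mult_mono) auto
  finally have T2: "l * \<mu> * wsum p w' y' * sq_norm p v' \<le> l * \<mu> * S * wsum p w' y' + 4 * l\<^sup>2 * E * (D * (1 + A * q))"
    using E0 by (simp add: mult_left_mono)
  \<comment> \<open>Passing from \<open>v'\<close> to \<open>v\<close> in the tail form costs
    \<open>4 l E\<close>, because \<open>h / D'\<close> and \<open>hG / D'\<close> are bounded by
    \<open>sqrt S\<close> and 1. Passing from \<open>D'\<close> to \<open>D\<close> costs the factor
    \<open>(1 + A q)^2\<close>.\<close>
  have T3: "(v k * s * q + tail_form p (Suc k) v y)\<^sup>2 / (1 + A * q)\<^sup>2 / D\<^sup>2 - 4 * l * E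
      \<le> (tail_form p k v' y' / D')\<^sup>2" if k: "k \<in> {1..p}" for k
  proof -
    define h where "h = tail_form p k v y'"
    define hG where "hG = tail_form p k (\<lambda>i. y i / D) y'"
    have h: "h = v k * s * q + tail_form p (Suc k) v y"
      unfolding h_def y'_def tail_form_shift_in[OF k] by simp
    have 1: "tail_form p k v' y' = h + l * c * hG" unfolding h_def hG_def v'_def by (rule tail_form_add)
    have "\<bar>h\<bar> \<le> sqrt S * D'" unfolding h_def D'_def
      by (rule abs_tail_form_le) (use y'0 y'nn vS k in auto)
    then have hb: "\<bar>h / D'\<bar> \<le> sqrt S" using D'1 by (simp add: field_simps)
    have "\<bar>hG\<bar> \<le> 1 * D'" unfolding hG_def D'_def
      by (rule abs_tail_form_le) (use y'0 y'nn G k in \<open>auto simp: abs_of_nonneg simp del: abs_divide\<close>)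
    then have hGb: "\<bar>hG / D'\<bar> \<le> 1" using D'1 by (simp add: field_simps)
    have "\<bar>2 * (h / D') * (c * (hG / D'))\<bar> \<le> 2 * sqrt S * (\<bar>c\<bar> * 1)"
      unfolding abs_mult using hb hGb S0 by (intro mult_mono) auto
    also have "\<dots> \<le> S + c\<^sup>2"
    proof -
      have "0 \<le> (sqrt S - \<bar>c\<bar>)\<^sup>2" by simp
      also have "\<dots> = (sqrt S)\<^sup>2 + \<bar>c\<bar>\<^sup>2 - 2 * sqrt S * \<bar>c\<bar>" by (simp add: power2_diff)
      finally show ?thesis using S0 by simp
    qed
    also have "\<dots> \<le> 4 * E" using c2 base by (smt (verit) zero_le_power2 mult_nonneg_nonneg)
    finally have cross: "- (4 * E) \<le> 2 * (h / D') * (c * (hG / D'))" by linarith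
    have "(tail_form p k v' y' / D')\<^sup>2 = (h / D')\<^sup>2 + l * (2 * (h / D') * (c * (hG / D'))) + (l * c * hG / D')\<^sup>2"
      unfolding 1 add_divide_distrib power2_sum by (simp add: algebra_simps)
    moreover have "l * (- (4 * E)) \<le> l * (2 * (h / D') * (c * (hG / D')))"
      using cross l by (intro mult_left_mono) auto
    moreover have "0 \<le> (l * c * hG / D')\<^sup>2" by simp
    ultimately have "(h / D')\<^sup>2 - 4 * l * E \<le> (tail_form p k v' y' / D')\<^sup>2" by linarith
    moreover have "h\<^sup>2 / (1 + A * q)\<^sup>2 / D\<^sup>2 \<le> (h / D')\<^sup>2"
    proof -
      have "D'\<^sup>2 \<le> (D * (1 + A * q))\<^sup>2" using D'D D'1 by (intro power_mono) auto
      then have "h\<^sup>2 / (D * (1 + A * q))\<^sup>2 \<le> h\<^sup>2 / D'\<^sup>2"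
        using D'1 by (intro divide_left_mono) (auto intro!: mult_pos_pos)
      then show ?thesis by (simp add: power_divide power_mult_distrib mult.commute)
    qed
    ultimately show ?thesis unfolding h by linarith
  qed
  define Q where "Q k = (v k * s * q + tail_form p (Suc k) v y)\<^sup>2 / (1 + A * q)\<^sup>2 / D\<^sup>2" for k
  have "(\<Sum>k\<in>{1..p}. \<kappa> ^ (k - 1) * Q k) - 4 * p * l * E \<le> (\<Sum>k\<in>{1..p}. \<kappa> ^ (k - 1) * (tail_form p k v' y' / D')\<^sup>2)"
  proof -
    have "(\<Sum>k\<in>{1..p}. \<kappa> ^ (k - 1) * Q k) - 4 * p * l * E = (\<Sum>k\<in>{1..p}. \<kappa> ^ (k - 1) * Q k - 4 * l * E)"
      by (simp add: sum_subtractf)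
    also have "\<dots> \<le> (\<Sum>k\<in>{1..p}. \<kappa> ^ (k - 1) * (tail_form p k v' y' / D')\<^sup>2)"
    proof (rule sum_mono)
      fix k assume k: "k \<in> {1..p}"
      have "\<kappa> ^ (k - 1) * (4 * l * E) \<le> 1 * (4 * l * E)"
        using kap l E0 by (intro mult_right_mono) (auto simp: power_le_one)
      moreover have "\<kappa> ^ (k - 1) * (Q k - 4 * l * E) \<le> \<kappa> ^ (k - 1) * (tail_form p k v' y' / D')\<^sup>2"
        using T3[OF k] kap unfolding Q_def by (intro mult_left_mono) auto
      ultimately show "\<kappa> ^ (k - 1) * Q k - 4 * l * E \<le> \<kappa> ^ (k - 1) * (tail_form p k v' y' / D')\<^sup>2"
        by (simp add: algebra_simps)
    qed
    finally show ?thesis .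
  qed
  then have "l * ((\<Sum>k\<in>{1..p}. \<kappa> ^ (k - 1) * Q k) - 4 * p * l * E) \<le> l * (\<Sum>k\<in>{1..p}. \<kappa> ^ (k - 1) * (tail_form p k v' y' / D')\<^sup>2)"
    using l by (intro mult_left_mono) auto
  then have T3': "- l * (\<Sum>k\<in>{1..p}. \<kappa> ^ (k - 1) * (tail_form p k v' y' / D')\<^sup>2) \<le> - l * (\<Sum>k\<in>{1..p}. \<kappa> ^ (k - 1) * Q k) + l\<^sup>2 * (4 * p * E)"
    by (simp add: power2_eq_square algebra_simps)
  have "1 * 1 \<le> D * (1 + A * q)" using D1 A q by (intro mult_mono) auto
  then have DA: "1 \<le> D * (1 + A * q)" by simp
  have "(3 * E + 4 * p * E) * 1 \<le> (3 * E + 4 * p * E) * (D * (1 + A * q))"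
    using DA E0 by (intro mult_left_mono) auto
  then have "l\<^sup>2 * (3 * E + 4 * p * E) \<le> l\<^sup>2 * ((3 * E + 4 * p * E) * (D * (1 + A * q)))"
    by (intro mult_left_mono) auto
  \<comment> \<open>The constant \<open>7 + 4 p\<close>: 3 from the norm, 4 from its product with
    \<open>wsum\<close>, and 4 from each of the \<open>p\<close> tail forms.\<close>
  then have fin: "l\<^sup>2 * (3 * E) + l\<^sup>2 * (4 * p * E) + 4 * l\<^sup>2 * E * (D * (1 + A * q)) \<le> l\<^sup>2 * ((7 + 4 * p) * E * (D * (1 + A * q)))"
    by (simp add: algebra_simps)
  have "lyap p \<kappa> \<mu> l w' v' y' = sq_norm p v' + l * \<mu> * wsum p w' y' * sq_norm p v' - l * (\<Sum>k\<in>{1..p}. \<kappa> ^ (k - 1) * (tail_form p k v' y' / D')\<^sup>2)"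
    unfolding lyap_def D'_def by (simp add: algebra_simps)
  also have "\<dots> \<le> S - 3/2 * l * g\<^sup>2 + 2 * l * B\<^sup>2 + 2 * l * \<sigma> * g * \<zeta> + l * \<mu> * S * wsum p w' y'
      + l\<^sup>2 * ((7 + 4 * p) * E * (D * (1 + A * q))) - l * (\<Sum>k\<in>{1..p}. \<kappa> ^ (k - 1) * Q k)"
    using T1 T2 T3' fin by linarith
  finally show ?thesis
    unfolding v'_def y'_def V'eq[unfolded y'_def] Q_def E_def C0_def \<sigma>_def \<zeta>_def
    by (simp add: algebra_simps)
qed

text \<open>Each of the \<open>p\<close> subtracted squares is at most \<open>sq_norm p v\<close>,
  so \<open>l * p \<le> 1/2\<close> limits the loss to one half.\<close>

lemma lyap_ge:
  assumes "p \<ge> 1" "y 0 = 1" "\<And>i. i \<le> p \<Longrightarrow> 0 \<le> y i" "0 \<le> l" "l * p \<le> 1/2" "0 \<le> \<mu>" "0 \<le> \<kappa>" "\<kappa> \<le> 1"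
    "\<And>i. i \<in> {1..p} \<Longrightarrow> 0 \<le> w i"
  shows "sq_norm p v / 2 \<le> lyap p \<kappa> \<mu> l w v y"
proof -
  have D: "1 \<le> norm1 p y" using assms(2) by (rule norm1_ge_1)
  have S: "0 \<le> sq_norm p v" by (rule sq_norm_nonneg)
  have "(\<Sum>k\<in>{1..p}. \<kappa> ^ (k - 1) * (tail_form p k v y / norm1 p y)\<^sup>2) \<le> (\<Sum>k\<in>{1..p}. sq_norm p v)"
  proof (rule sum_mono)
    fix k assume k: "k \<in> {1..p}"
    have "\<bar>tail_form p k v y\<bar> \<le> sqrt (sq_norm p v) * norm1 p y"
      by (rule abs_tail_form_le) (use assms k abs_le_sqrt_sq_norm in auto)
    then have "\<bar>tail_form p k v y / norm1 p y\<bar> \<le> sqrt (sq_norm p v)" using D by (simp add: field_simps)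
    then have "(tail_form p k v y / norm1 p y)\<^sup>2 \<le> sq_norm p v"
      using S by (metis abs_le_square_iff abs_of_nonneg real_sqrt_ge_0_iff real_sqrt_pow2)
    moreover have "\<kappa> ^ (k - 1) * (tail_form p k v y / norm1 p y)\<^sup>2 \<le> 1 * (tail_form p k v y / norm1 p y)\<^sup>2"
      using assms by (intro mult_right_mono) (auto simp: power_le_one)
    ultimately show "\<kappa> ^ (k - 1) * (tail_form p k v y / norm1 p y)\<^sup>2 \<le> sq_norm p v" by linarith
  qed
  then have "l * (\<Sum>k\<in>{1..p}. \<kappa> ^ (k - 1) * (tail_form p k v y / norm1 p y)\<^sup>2) \<le> l * (p * sq_norm p v)"
    using assms by (intro mult_left_mono) auto
  also have "\<dots> = l * p * sq_norm p v" by simp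
  also have "\<dots> \<le> 1/2 * sq_norm p v" using assms S by (intro mult_right_mono) auto
  finally have *: "l * (\<Sum>k\<in>{1..p}. \<kappa> ^ (k - 1) * (tail_form p k v y / norm1 p y)\<^sup>2) \<le> sq_norm p v / 2" by simp
  have "0 \<le> wsum p w y" unfolding wsum_def using assms by (intro sum_nonneg) auto
  then have "sq_norm p v * 1 \<le> sq_norm p v * (1 + l * \<mu> * wsum p w y)"
    using assms S by (intro mult_left_mono) auto
  with * show ?thesis unfolding lyap_def by linarith
qed

lemma one_wsum_le_norm1:
  assumes "y 0 = 1" "\<And>i. i \<le> p \<Longrightarrow> 0 \<le> y i" "\<And>i. i \<in> {1..p} \<Longrightarrow> w i \<le> 1"
  shows "1 + wsum p w y \<le> norm1 p y"
proof -
  have "wsum p w y \<le> (\<Sum>i\<in>{1..p}. y i)"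
    unfolding wsum_def using assms by (intro sum_mono) (metis assms(2,3) atLeastAtMost_iff mult.left_neutral mult_right_mono)
  then show ?thesis using assms by (simp add: norm1_nonneg_eq atMost_split)
qed

text \<open>Weights at most 1 give \<open>1 + wsum p w y \<le> norm1 p y\<close>. The bound converts
  a decrease proportional to \<open>|v|^2 D\<close> into one proportional to
  \<open>lyap\<close>.\<close>

lemma lyap_le:
  assumes "y 0 = 1" "\<And>i. i \<le> p \<Longrightarrow> 0 \<le> y i" "0 \<le> l" "l \<le> 1" "0 \<le> \<mu>" "\<mu> \<le> 1" "0 \<le> \<kappa>"
    "\<And>i. i \<in> {1..p} \<Longrightarrow> 0 \<le> w i \<and> w i \<le> 1"
  shows "lyap p \<kappa> \<mu> l w v y \<le> sq_norm p v * norm1 p y"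
proof -
  have "0 \<le> l * (\<Sum>k\<in>{1..p}. \<kappa> ^ (k - 1) * (tail_form p k v y / norm1 p y)\<^sup>2)"
    using assms by (intro mult_nonneg_nonneg sum_nonneg) auto
  moreover have "sq_norm p v * (1 + l * \<mu> * wsum p w y) \<le> sq_norm p v * norm1 p y"
  proof (rule mult_left_mono[OF _ sq_norm_nonneg])
    have "0 \<le> wsum p w y" unfolding wsum_def using assms by (intro sum_nonneg) auto
    then have "l * \<mu> * wsum p w y \<le> 1 * wsum p w y"
      using assms by (intro mult_right_mono mult_le_one) auto
    then show "1 + l * \<mu> * wsum p w y \<le> norm1 p y"
      using one_wsum_le_norm1[of y p w] assms by auto
  qed
  ultimately show ?thesis unfolding lyap_def by linarith
qed

section \<open>The law of the noise and the conditional drift\<close>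

locale square_noise = prob_space \<nu> for \<nu> :: "real measure" +
  assumes sets_noise [measurable_cong]: "sets \<nu> = sets borel"
    and int6: "integrable \<nu> (\<lambda>z. z ^ 6)"
    and square_mean: "(\<integral>z. z\<^sup>2 \<partial>\<nu>) = 1"
    and square_nonconst: "\<not> (AE z in \<nu>. z\<^sup>2 = 1)"
begin

lemma integrable_even_power:
  assumes "n \<le> 3"
  shows "integrable \<nu> (\<lambda>z. (z\<^sup>2) ^ n)"
proof (rule Bochner_Integration.integrable_bound[where f = "\<lambda>z. 1 + z ^ 6"])
  show "integrable \<nu> (\<lambda>z. 1 + z ^ 6)" using int6 by simp
  have "\<bar>(z\<^sup>2) ^ n\<bar> \<le> 1 + z ^ 6" for z :: real
  proof (cases "z\<^sup>2 \<le> 1")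
    case True
    then have "(z\<^sup>2) ^ n \<le> 1" by (rule power_le_one[OF zero_le_power2])
    then show ?thesis by (simp add: add_increasing2)
  next
    case False
    then have "(z\<^sup>2) ^ n \<le> (z\<^sup>2) ^ 3" using assms by (intro power_increasing) auto
    then show ?thesis by (simp flip: power_mult)
  qed
  then show "AE z in \<nu>. norm ((z\<^sup>2) ^ n) \<le> norm (1 + z ^ 6)"
    by (intro AE_I2) (auto intro: order_trans[OF _ abs_ge_self])
qed measurable

lemma integrable_square: "integrable \<nu> (\<lambda>z. z\<^sup>2)"
  using integrable_even_power[of 1] by simp

text \<open>The integral is the quadratic form of the Gram matrix of \<open>z^2\<close> and 1 under
  the weight \<open>1 / (1 + A z^2)^2\<close>, which comes from the growth of \<open>D\<close> in
  one step. It is definite because \<open>z^2\<close> is not almost surely constant.\<close>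

lemma weighted_square_gram:
  assumes A: "0 < A"
  shows "\<exists>\<kappa>>0. \<kappa> \<le> 1 \<and> (\<forall>P H. integrable \<nu> (\<lambda>z. (P * z\<^sup>2 + H)\<^sup>2 / (1 + A * z\<^sup>2)\<^sup>2) \<and>
    \<kappa> * (P\<^sup>2 + H\<^sup>2) \<le> (\<integral>z. (P * z\<^sup>2 + H)\<^sup>2 / (1 + A * z\<^sup>2)\<^sup>2 \<partial>\<nu>))"
proof -
  define f where "f n z = (z\<^sup>2) ^ n / (1 + A * z\<^sup>2)\<^sup>2" for n :: nat and z :: real
  define m where "m n = (\<integral>z. f n z \<partial>\<nu>)" for n
  have den: "1 \<le> (1 + A * z\<^sup>2)\<^sup>2" for z
    using A by simp
  have f_int: "integrable \<nu> (f n)" if "n \<le> 3" for n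
  proof (rule Bochner_Integration.integrable_bound[OF integrable_even_power[OF that]])
    show "AE z in \<nu>. norm (f n z) \<le> norm ((z\<^sup>2) ^ n)"
    proof (rule AE_I2)
      fix z
      have "0 < 1 + A * z\<^sup>2" using A by (simp add: add_pos_nonneg)
      then have "(z\<^sup>2) ^ n / (1 + A * z\<^sup>2)\<^sup>2 \<le> (z\<^sup>2) ^ n / 1"
        using den[of z] by (intro divide_left_mono) simp_all
      then show "norm (f n z) \<le> norm ((z\<^sup>2) ^ n)" by (simp add: f_def)
    qed
    show "f n \<in> borel_measurable \<nu>" unfolding f_def by measurable
  qed
  have expand: "(P * z\<^sup>2 + H)\<^sup>2 / (1 + A * z\<^sup>2)\<^sup>2 = P\<^sup>2 * f 2 z + 2 * P * H * f 1 z + H\<^sup>2 * f 0 z" for P H z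
    unfolding f_def power2_sum power_mult_distrib by (simp add: add_divide_distrib algebra_simps)
  have int: "integrable \<nu> (\<lambda>z. (P * z\<^sup>2 + H)\<^sup>2 / (1 + A * z\<^sup>2)\<^sup>2)" for P H
    unfolding expand by (intro Bochner_Integration.integrable_add integrable_mult_right f_int) auto
  have val: "(\<integral>z. (P * z\<^sup>2 + H)\<^sup>2 / (1 + A * z\<^sup>2)\<^sup>2 \<partial>\<nu>) = P\<^sup>2 * m 2 + 2 * P * H * m 1 + H\<^sup>2 * m 0" for P H
    unfolding expand m_def using f_int[of 0] f_int[of 1] f_int[of 2] by simp
  have den0: "(1 + A * z\<^sup>2)\<^sup>2 \<noteq> 0" for z using den[of z] by linarith
  have m_nn: "0 \<le> m n" for n unfolding m_def f_def by (intro integral_nonneg_AE AE_I2) simp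
  have m0: "0 < m 0"
  proof (rule ccontr)
    assume "\<not> 0 < m 0"
    then have "m 0 = 0" using m_nn[of 0] by simp
    then have "AE z in \<nu>. f 0 z = 0"
      unfolding m_def using f_int[of 0] by (subst (asm) integral_nonneg_eq_0_iff_AE) (auto simp: f_def)
    then have "AE z in \<nu>. False" using den0 by (auto simp: f_def)
    then show False by simp
  qed
  \<comment> \<open>The constant \<open>c\<close> is the weighted mean of \<open>z^2\<close>, and
    the form at \<open>(1, -c)\<close> equals the determinant over \<open>m 0\<close>. If this is
    not positive, then \<open>z^2 = c\<close> almost everywhere, and the mean 1 forces
    \<open>c = 1\<close>.\<close>
  have det: "0 < m 0 * m 2 - (m 1)\<^sup>2"
  proof (rule ccontr)
    assume neg: "\<not> 0 < m 0 * m 2 - (m 1)\<^sup>2"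
    define c where "c = m 1 / m 0"
    let ?h = "\<lambda>z. (1 * z\<^sup>2 + (-c))\<^sup>2 / (1 + A * z\<^sup>2)\<^sup>2"
    have "integral\<^sup>L \<nu> ?h = m 2 - (m 1)\<^sup>2 / m 0"
      unfolding val c_def using m0 by (simp add: power2_eq_square field_simps)
    also have "\<dots> \<le> 0" using neg m0 by (simp add: field_simps)
    finally have "integral\<^sup>L \<nu> ?h = 0" by (intro antisym integral_nonneg_AE AE_I2) auto
    then have "AE z in \<nu>. ?h z = 0"
      by (subst (asm) integral_nonneg_eq_0_iff_AE) (use int[of 1 "-c"] in auto)
    then have ae: "AE z in \<nu>. z\<^sup>2 = c" by (rule AE_mp) (use den0 in \<open>auto intro!: AE_I2\<close>)
    then have "(\<integral>z. z\<^sup>2 \<partial>\<nu>) = (\<integral>z. c \<partial>\<nu>)"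
      by (intro integral_cong_AE) auto
    then have "c = 1" using square_mean prob_space by simp
    with ae square_nonconst show False by simp
  qed
  \<comment> \<open>Determinant over trace: a lower bound for the smaller eigenvalue, since the
    larger one is at most the trace.\<close>
  define \<kappa>' where "\<kappa>' = (m 0 * m 2 - (m 1)\<^sup>2) / (m 0 + m 2)"
  have tr: "0 < m 0 + m 2" using m0 m_nn[of 2] by linarith
  have k0: "0 < \<kappa>'" unfolding \<kappa>'_def using det tr by simp
  have k2': "\<kappa>' < m 2"
  proof -
    have "m 2 \<noteq> 0" using det by (auto simp: not_less)
    then have "0 < m 2 * m 2" using m_nn[of 2] by simp
    moreover have "0 \<le> (m 1)\<^sup>2" by simp
    ultimately have "m 0 * m 2 - (m 1)\<^sup>2 < m 2 * (m 0 + m 2)" unfolding distrib_left mult.commute[of "m 2" "m 0"] by linarith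
    then show ?thesis unfolding \<kappa>'_def using tr by (simp add: divide_less_eq)
  qed
  have kd: "(m 1)\<^sup>2 \<le> (m 2 - \<kappa>') * (m 0 - \<kappa>')"
  proof -
    have "(m 2 - \<kappa>') * (m 0 - \<kappa>') = m 0 * m 2 - \<kappa>' * (m 0 + m 2) + \<kappa>'\<^sup>2"
      by (simp add: algebra_simps power2_eq_square)
    also have "\<kappa>' * (m 0 + m 2) = m 0 * m 2 - (m 1)\<^sup>2" unfolding \<kappa>'_def using tr by simp
    finally show ?thesis by simp
  qed
  \<comment> \<open>Completing the square: multiplied by \<open>m 2 - \<kappa>'\<close>, the
    difference of the two sides is a square plus a nonnegative multiple of
    \<open>H^2\<close>.\<close>
  have low: "\<kappa>' * (P\<^sup>2 + H\<^sup>2) \<le> P\<^sup>2 * m 2 + 2 * P * H * m 1 + H\<^sup>2 * m 0" for P H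
  proof -
    have "0 \<le> ((m 2 - \<kappa>') * P + m 1 * H)\<^sup>2 + ((m 2 - \<kappa>') * (m 0 - \<kappa>') - (m 1)\<^sup>2) * H\<^sup>2"
      using kd by simp
    also have "\<dots> = (m 2 - \<kappa>') * ((P\<^sup>2 * m 2 + 2 * P * H * m 1 + H\<^sup>2 * m 0) - \<kappa>' * (P\<^sup>2 + H\<^sup>2))"
      by (simp add: power2_eq_square algebra_simps)
    finally show ?thesis using k2' by (simp add: zero_le_mult_iff)
  qed
  show ?thesis
  proof (intro exI[of _ "min 1 \<kappa>'"] conjI allI)
    fix P H :: real
    have "min 1 \<kappa>' * (P\<^sup>2 + H\<^sup>2) \<le> \<kappa>' * (P\<^sup>2 + H\<^sup>2)" by (intro mult_right_mono) auto
    then show "min 1 \<kappa>' * (P\<^sup>2 + H\<^sup>2) \<le> (\<integral>z. (P * z\<^sup>2 + H)\<^sup>2 / (1 + A * z\<^sup>2)\<^sup>2 \<partial>\<nu>)"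
      unfolding val using low[of P H] by linarith
  qed (use k0 int in auto)
qed

end

text \<open>In the conditional mean of \<open>wsum p w'\<close> after one step, the entry
  \<open>y i\<close> has the coefficient \<open>a i + w' (Suc i)\<close>, where the second term is
  absent for \<open>i = p\<close> because that entry leaves the regressor. The last clause thus
  makes the functional drop by at least \<open>e\<close> per unit of each entry, apart from the
  contribution of \<open>a 0\<close>. \<open>B\<close> bounds the distance from the coefficients to
  the target \<open>\<alpha>\<close>.\<close>

definition step_ok :: "nat \<Rightarrow> real \<Rightarrow> real \<Rightarrow> real \<Rightarrow> real \<Rightarrow> (nat \<Rightarrow> real) \<Rightarrow> (nat \<Rightarrow> real) \<Rightarrow> (nat \<Rightarrow> real) \<Rightarrow> (nat \<Rightarrow> real)
    \<Rightarrow> (nat \<Rightarrow> real) \<Rightarrow> bool" where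
  "step_ok p A e \<rho> B y a w w' \<alpha> \<longleftrightarrow>
     y 0 = 1 \<and> (\<forall>i\<le>p. 0 \<le> y i) \<and> \<rho> \<le> a 0 \<and> (\<forall>i\<le>p. 0 \<le> a i \<and> a i \<le> A) \<and> (\<forall>i\<le>p. \<bar>a i - \<alpha> i\<bar> \<le> B) \<and>
     (\<forall>i\<in>{1..p}. 0 \<le> w i \<and> w i \<le> 1) \<and> (\<forall>i\<in>{1..p}. 0 \<le> w' i \<and> w' i \<le> 1) \<and> w' 1 = 1 \<and>
     (\<forall>i\<in>{1..p}. a i + (if i < p then w' (Suc i) else 0) \<le> w i - e)"

context square_noise
begin

text \<open>The constants are chosen before the step size, the weights, the regressor and the error.
  This uniformity is what allows the inequality to be iterated along the process while the step size
  tends to 0.\<close>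

lemma lyap_drift:
  fixes p :: nat and A e \<rho> Bm :: real
  assumes p: "p \<ge> 1" and A: "1 \<le> A" and e: "0 < e" "e \<le> 1" and rho: "0 < \<rho>" "\<rho> \<le> 1"
  shows "\<exists>\<kappa> \<mu> c L (l0::real). 0 < \<kappa> \<and> \<kappa> \<le> 1 \<and> 0 < \<mu> \<and> \<mu> \<le> 1 \<and> 0 < c \<and> c \<le> 1 \<and> 0 \<le> L \<and> 0 < l0 \<and> l0 \<le> 1 \<and> l0 * p \<le> 1/2 \<and>
    (\<forall>l B w w' a v y \<alpha>. 0 < l \<and> l \<le> l0 \<and> 0 \<le> B \<and> B \<le> Bm \<and> step_ok p A e \<rho> B y a w w' \<alpha> \<longrightarrow>
      (\<integral>\<^sup>+z. ennreal (lyap p \<kappa> \<mu> l w' (nlms p l \<alpha> v y ((\<Sum>i\<le>p. a i * y i) * z\<^sup>2))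
              (shift_in p ((\<Sum>i\<le>p. a i * y i) * z\<^sup>2) y)) \<partial>\<nu>)
        \<le> ennreal ((1 - c * l) * lyap p \<kappa> \<mu> l w v y + 2 * l * B\<^sup>2 + l\<^sup>2 * L * norm1 p y))"
proof -
  have A0: "0 < A" using A by simp
  obtain \<kappa> where kap: "0 < \<kappa>" "\<kappa> \<le> 1"
    and gram_int: "\<And>P H. integrable \<nu> (\<lambda>z. (P * z\<^sup>2 + H)\<^sup>2 / (1 + A * z\<^sup>2)\<^sup>2)"
    and gram: "\<And>P H. \<kappa> * (P\<^sup>2 + H\<^sup>2) \<le> (\<integral>z. (P * z\<^sup>2 + H)\<^sup>2 / (1 + A * z\<^sup>2)\<^sup>2 \<partial>\<nu>)"
    using weighted_square_gram[OF A0] by blast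
  define m where "m = (\<integral>z. (1 + (z\<^sup>2 - 1)\<^sup>2) * (1 + A * z\<^sup>2) \<partial>\<nu>)"
  \<comment> \<open>A cubic in the squared noise, so that the sixth moment makes its mean
    \<open>m\<close> finite.\<close>
  have poly: "(1 + (z\<^sup>2 - 1)\<^sup>2) * (1 + A * z\<^sup>2) = A * (z\<^sup>2)^3 + (1 - 2 * A) * (z\<^sup>2)^2 + (2 * A - 2) * (z\<^sup>2)^1 + 2 * (z\<^sup>2)^0" for z :: real
    by (simp add: power2_eq_square power3_eq_cube algebra_simps)
  have m_int: "integrable \<nu> (\<lambda>z. (1 + (z\<^sup>2 - 1)\<^sup>2) * (1 + A * z\<^sup>2))"
    unfolding poly by (intro Bochner_Integration.integrable_add integrable_mult_right integrable_even_power) auto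
  have m0: "0 \<le> m" unfolding m_def using A by (intro integral_nonneg_AE AE_I2) simp
  define cs where "cs = \<kappa> ^ p * \<rho>\<^sup>2"
  define b where "b = A + e"
  define R where "R = 2 * b / e"
  \<comment> \<open>For \<open>D \<ge> R\<close> the drift of \<open>V\<close> is negative; for \<open>D \<le> R\<close> the term \<open>cs/D^2\<close> compensates it once \<open>\<mu>\<close> is small.\<close>
  define \<mu> where "\<mu> = min 1 (cs / (2 * b * R\<^sup>2))"
  define \<gamma> where "\<gamma> = \<mu> * e / 2"
  define L where "L = (7 + 4 * p) * (1 + A\<^sup>2 + Bm\<^sup>2) * m"
  \<comment> \<open>The first entry is the condition of \<open>lyap_ge\<close>. The second gives
    \<open>l * L \<le> \<gamma> / 2\<close>: half of the gain \<open>l \<gamma> S D\<close> absorbs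
    the part of the remainder that is proportional to \<open>S\<close>, and the other half yields
    the contraction rate \<open>c = \<gamma> / 2\<close>.\<close>
  define l0 where "l0 = min (1 / (2 * p)) (\<gamma> / (2 * L + 1))"
  define c where "c = \<gamma> / 2"
  have cs0: "0 < cs" unfolding cs_def using kap rho by simp
  have b0: "0 < b" unfolding b_def using A e by simp
  have R1: "1 \<le> R" unfolding R_def b_def using A e by (simp add: field_simps)
  have mu: "0 < \<mu>" "\<mu> \<le> 1" unfolding \<mu>_def using cs0 b0 R1 by (auto intro!: divide_pos_pos mult_pos_pos)
  have gam: "0 < \<gamma>" "\<gamma> \<le> 1" unfolding \<gamma>_def using mu e mult_mono[of \<mu> 1 e 1] by auto
  have L0: "0 \<le> L" unfolding L_def using m0 by (intro mult_nonneg_nonneg) auto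
  have l0: "0 < l0" unfolding l0_def using gam L0 p by auto
  have l0p: "l0 * p \<le> 1/2"
  proof -
    have "l0 * p \<le> 1 / (2 * p) * p" unfolding l0_def by (intro mult_right_mono) auto
    then show ?thesis using p by simp
  qed
  have "l0 \<le> 1 / (2 * p)" unfolding l0_def by simp
  also have "\<dots> \<le> 1" using p by (simp add: field_simps)
  finally have l01: "l0 \<le> 1" .
  have key: "- cs / D\<^sup>2 + \<mu> * (b - e * D) \<le> - \<gamma> * D" if D: "1 \<le> D" for D
  proof (cases "R \<le> D")
    case True
    then have "b \<le> e * D / 2" unfolding R_def using e by (simp add: field_simps)
    then have "\<mu> * (b - e * D) \<le> \<mu> * (- e * D / 2)" using mu by (intro mult_left_mono) auto
    moreover have "0 \<le> cs / D\<^sup>2" using cs0 by simp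
    ultimately show ?thesis unfolding \<gamma>_def by simp
  next
    case False
    have "\<mu> \<le> cs / (2 * b * R\<^sup>2)" unfolding \<mu>_def by simp
    then have "2 * b * \<mu> \<le> cs / R\<^sup>2" using b0 R1 by (simp add: field_simps)
    also have "\<dots> \<le> cs / D\<^sup>2"
      using False D cs0 by (intro divide_left_mono power_mono) (auto intro!: mult_pos_pos)
    finally have "\<mu> * b \<le> cs / D\<^sup>2 - \<mu> * b" by (simp add: mult_ac)
    moreover have "0 \<le> \<mu> * b" "0 \<le> \<mu> * e * D" using mu b0 e D by (auto intro!: mult_nonneg_nonneg)
    ultimately show ?thesis unfolding \<gamma>_def by (simp add: algebra_simps)
  qed
  show ?thesis
  proof (rule exI[of _ \<kappa>], rule exI[of _ \<mu>], rule exI[of _ c], rule exI[of _ L], rule exI[of _ l0], intro conjI allI impI, goal_cases)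
    case (11 l B w w' a v y \<alpha>)
    then have l: "0 < l" "l \<le> l0" and B: "0 \<le> B" "B \<le> Bm" and y0: "y 0 = (1::real)"
      and ynn: "\<And>i. i \<le> p \<Longrightarrow> 0 \<le> y i" and a0: "\<rho> \<le> a 0"
      and aA: "\<And>i. i \<le> p \<Longrightarrow> 0 \<le> a i \<and> a i \<le> A"
      and w: "\<And>i. i \<in> {1..p} \<Longrightarrow> 0 \<le> w i \<and> w i \<le> 1"
      and w': "\<And>i. i \<in> {1..p} \<Longrightarrow> 0 \<le> w' i \<and> w' i \<le> 1" and w'1: "w' 1 = 1"
      and aw: "\<And>i. i \<in> {1..p} \<Longrightarrow> a i + (if i < p then w' (Suc i) else 0) \<le> w i - e"
      and a\<alpha>: "\<And>i. i \<le> p \<Longrightarrow> \<bar>a i - \<alpha> i\<bar> \<le> B"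
      unfolding step_ok_def by blast+
    define D where "D = norm1 p y"
    define S where "S = sq_norm p v"
    define g where "g = tail_form p 1 v y / D"
    define s where "s = (\<Sum>i\<le>p. a i * y i)"
    \<comment> \<open>The normalised bias: an average of \<open>a i - \<alpha> i\<close> with
      weights \<open>y i / D\<close> summing to 1, hence bounded by \<open>B\<close>.\<close>
    define \<beta> where "\<beta> = (\<Sum>i\<le>p. (a i - \<alpha> i) * y i) / D"
    define H where "H k = tail_form p (Suc k) v y" for k
    define V0 where "V0 = (\<Sum>i\<in>{1..<p}. w' (Suc i) * y i)"
    define F where "F z = lyap p \<kappa> \<mu> l w' (nlms p l \<alpha> v y (s * z\<^sup>2)) (shift_in p (s * z\<^sup>2) y)" for z
    define U where "U z = S - 3/2 * l * g\<^sup>2 + 2 * l * B\<^sup>2 + 2 * l * (s / D) * g * (z\<^sup>2 - 1)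
      + l * \<mu> * S * (s * z\<^sup>2 + V0)
      + l\<^sup>2 * ((7 + 4 * p) * (1 + A\<^sup>2 + Bm\<^sup>2) * (1 + S) * D) * ((1 + (z\<^sup>2 - 1)\<^sup>2) * (1 + A * z\<^sup>2))
      - l * (\<Sum>k\<in>{1..p}. \<kappa> ^ (k - 1) * ((v k * s * z\<^sup>2 + H k)\<^sup>2 / (1 + A * z\<^sup>2)\<^sup>2 / D\<^sup>2))" for z
    have D1: "1 \<le> D" unfolding D_def using y0 by (rule norm1_ge_1)
    have Dsum: "D = (\<Sum>i\<le>p. y i)" unfolding D_def using ynn by (rule norm1_nonneg_eq)
    have S0: "0 \<le> S" unfolding S_def by (rule sq_norm_nonneg)
    have l1: "l \<le> 1" using l l01 by simp
    have lp: "l * p \<le> 1/2" using l l0p mult_right_mono[of l l0 p] by simp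
    have s0: "0 \<le> s" unfolding s_def using aA ynn by (intro sum_nonneg) auto
    have sA: "s \<le> A * D" unfolding s_def Dsum sum_distrib_left using aA ynn by (intro sum_mono mult_right_mono) auto
    have s\<rho>: "\<rho> \<le> s"
    proof -
      have "0 \<le> (\<Sum>i\<in>{1..p}. a i * y i)" using aA ynn by (intro sum_nonneg) auto
      then show ?thesis unfolding s_def atMost_split using y0 a0 by simp
    qed
    have "\<bar>\<Sum>i\<le>p. (a i - \<alpha> i) * y i\<bar> \<le> (\<Sum>i\<le>p. B * y i)"
      using a\<alpha> ynn B(1) by (intro order_trans[OF sum_abs] sum_mono) (auto simp: abs_mult intro!: mult_mono)
    also have "\<dots> = B * D" unfolding Dsum by (simp add: sum_distrib_left)
    finally have \<beta>B: "\<bar>\<beta>\<bar> \<le> B" unfolding \<beta>_def using D1 by (simp add: field_simps)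
    have FU: "F z \<le> U z" for z
    proof -
      have "nlms p l \<alpha> v y (s * z\<^sup>2) = (\<lambda>i. v i + l * ((z\<^sup>2 - 1) * (s / D) + \<beta> - g) * (y i / D))"
      proof
        fix i
        have t: "tail_form p 1 v y = (\<Sum>i\<le>p. v i * y i)" using y0 by (rule tail_form_1)
        have "D * \<beta> = s - (\<Sum>i\<le>p. \<alpha> i * y i)" "D * g = (\<Sum>i\<le>p. v i * y i)"
          unfolding \<beta>_def g_def t s_def using D1 by (simp_all add: left_diff_distrib sum_subtractf)
        moreover have "D * ((z\<^sup>2 - 1) * (s / D) + \<beta> - g) = (z\<^sup>2 - 1) * s + D * \<beta> - D * g"
          using D1 by (simp add: field_simps)
        ultimately have "D * ((z\<^sup>2 - 1) * (s / D) + \<beta> - g) = s * z\<^sup>2 - (\<Sum>k\<le>p. (v k + \<alpha> k) * y k)"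
          by (simp add: algebra_simps sum.distrib)
        then have "s * z\<^sup>2 - (\<Sum>k\<le>p. (v k + \<alpha> k) * y k) = D * ((z\<^sup>2 - 1) * (s / D) + \<beta> - g)" ..
        then show "nlms p l \<alpha> v y (s * z\<^sup>2) i = v i + l * ((z\<^sup>2 - 1) * (s / D) + \<beta> - g) * (y i / D)"
          unfolding nlms_def D_def[symmetric] using D1 by (simp add: power2_eq_square)
      qed
      then show ?thesis
        unfolding F_def U_def D_def S_def g_def H_def V0_def
        using lyap_rank_one_step[where p = p and y = y and l = l and \<mu> = \<mu> and \<kappa> = \<kappa> and q = "z\<^sup>2"
          and A = A and s = s and b = \<beta> and B = B and Bm = Bm and w' = w' and v = v]
          p y0 ynn l l1 mu kap A s0 sA \<beta>B B w' w'1
        unfolding D_def by simp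
    qed
    \<comment> \<open>Together with \<open>F z \<le> U z\<close> this bounds the integral of
      \<open>F\<close> by that of the integrable majorant \<open>U\<close>.\<close>
    have F0: "0 \<le> F z" for z
    proof -
      have "sq_norm p (nlms p l \<alpha> v y (s * z\<^sup>2)) / 2 \<le> F z"
        unfolding F_def using p l lp mu kap w' s0 ynn
        by (intro lyap_ge) (auto simp: shift_in_def)
      then show ?thesis using sq_norm_nonneg[of p "nlms p l \<alpha> v y (s * z\<^sup>2)"] by simp
    qed
    have q_int: "integrable \<nu> (\<lambda>z. z\<^sup>2 - 1)" using integrable_square by simp
    have V_int: "integrable \<nu> (\<lambda>z. s * z\<^sup>2 + V0)" using integrable_square by simp
    have q_hb: "has_bochner_integral \<nu> (\<lambda>z. z\<^sup>2 - 1) 0" "has_bochner_integral \<nu> (\<lambda>z. s * z\<^sup>2 + V0) (s + V0)"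
      using q_int V_int integrable_square square_mean by (simp_all add: has_bochner_integral_iff prob_space)
    have m_hb: "has_bochner_integral \<nu> (\<lambda>z. (1 + (z\<^sup>2 - 1)\<^sup>2) * (1 + A * z\<^sup>2)) m"
      using m_int by (simp add: has_bochner_integral_iff m_def)
    have G_hb: "has_bochner_integral \<nu> (\<lambda>z. (v k * s * z\<^sup>2 + H k)\<^sup>2 / (1 + A * z\<^sup>2)\<^sup>2)
        (\<integral>z. (v k * s * z\<^sup>2 + H k)\<^sup>2 / (1 + A * z\<^sup>2)\<^sup>2 \<partial>\<nu>)" for k
      using gram_int by (rule has_bochner_integral_integrable)
    have c_hb: "has_bochner_integral \<nu> (\<lambda>z. c) c" for c :: real
      by (simp add: has_bochner_integral_iff prob_space)
    have "has_bochner_integral \<nu> U (S - 3/2 * l * g\<^sup>2 + 2 * l * B\<^sup>2 + 2 * l * (s / D) * g * 0 + l * \<mu> * S * (s + V0)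
      + l\<^sup>2 * ((7 + 4 * p) * (1 + A\<^sup>2 + Bm\<^sup>2) * (1 + S) * D) * m
      - l * (\<Sum>k\<in>{1..p}. \<kappa> ^ (k - 1) * ((\<integral>z. (v k * s * z\<^sup>2 + H k)\<^sup>2 / (1 + A * z\<^sup>2)\<^sup>2 \<partial>\<nu>) / D\<^sup>2)))"
      unfolding U_def by (intro q_hb m_hb G_hb c_hb has_bochner_integral_diff has_bochner_integral_add
        has_bochner_integral_mult_right has_bochner_integral_sum has_bochner_integral_divide_zero)
    then have Uint: "integrable \<nu> U" and "integral\<^sup>L \<nu> U = S - 3/2 * l * g\<^sup>2 + 2 * l * B\<^sup>2 + l * \<mu> * S * (s + V0)
      + l\<^sup>2 * ((7 + 4 * p) * (1 + A\<^sup>2 + Bm\<^sup>2) * (1 + S) * D) * m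
      - l * (\<Sum>k\<in>{1..p}. \<kappa> ^ (k - 1) * ((\<integral>z. (v k * s * z\<^sup>2 + H k)\<^sup>2 / (1 + A * z\<^sup>2)\<^sup>2 \<partial>\<nu>) / D\<^sup>2))"
      by (simp_all add: has_bochner_integral_iff)
    note this(2)
    also have "\<dots> \<le> (1 - c * l) * lyap p \<kappa> \<mu> l w v y + 2 * l * B\<^sup>2 + l\<^sup>2 * L * D"
    proof -
      define q where "q k = (tail_form p k v y / D)\<^sup>2" for k
      have sV: "s + V0 \<le> wsum p w y + (b - e * D)"
      proof -
        have "s + V0 = a 0 + (\<Sum>i\<in>{1..p}. a i * y i) + (\<Sum>i\<in>{1..p}. (if i < p then w' (Suc i) else 0) * y i)"
        proof -
          have "V0 = (\<Sum>i\<in>{1..p}. (if i < p then w' (Suc i) else 0) * y i)"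
            unfolding V0_def by (rule sum.mono_neutral_cong_left) auto
          then show ?thesis unfolding s_def atMost_split using y0 by simp
        qed
        also have "\<dots> = a 0 + (\<Sum>i\<in>{1..p}. (a i + (if i < p then w' (Suc i) else 0)) * y i)"
          by (simp only: sum.distrib distrib_right add.assoc)
        also have "\<dots> \<le> A + (\<Sum>i\<in>{1..p}. (w i - e) * y i)"
          using aA[of 0] aw ynn by (intro add_mono sum_mono mult_right_mono) auto
        also have "\<dots> = A + wsum p w y - e * (\<Sum>i\<in>{1..p}. y i)"
          unfolding wsum_def by (simp add: left_diff_distrib sum_subtractf sum_distrib_left)
        also have "(\<Sum>i\<in>{1..p}. y i) = D - 1" unfolding Dsum atMost_split using y0 by simp
        finally show ?thesis unfolding b_def by (simp add: algebra_simps)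
      qed
      have G: "\<kappa> ^ k * \<rho>\<^sup>2 * ((v k)\<^sup>2 / D\<^sup>2) + \<kappa> ^ k * q (Suc k)
          \<le> \<kappa> ^ (k - 1) * ((\<integral>z. (v k * s * z\<^sup>2 + H k)\<^sup>2 / (1 + A * z\<^sup>2)\<^sup>2 \<partial>\<nu>) / D\<^sup>2)" if k: "k \<in> {1..p}" for k
      proof -
        have "\<rho>\<^sup>2 \<le> s\<^sup>2" using s\<rho> rho by (intro power_mono) auto
        then have "\<rho>\<^sup>2 * (v k)\<^sup>2 \<le> s\<^sup>2 * (v k)\<^sup>2" by (intro mult_right_mono) auto
        then have "\<rho>\<^sup>2 * (v k)\<^sup>2 \<le> (v k * s)\<^sup>2" by (simp add: power_mult_distrib mult.commute)
        then have "\<kappa> * (\<rho>\<^sup>2 * (v k)\<^sup>2 + (H k)\<^sup>2) \<le> \<kappa> * ((v k * s)\<^sup>2 + (H k)\<^sup>2)"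
          using kap by (intro mult_left_mono) auto
        also have "\<dots> \<le> (\<integral>z. (v k * s * z\<^sup>2 + H k)\<^sup>2 / (1 + A * z\<^sup>2)\<^sup>2 \<partial>\<nu>)" by (rule gram)
        finally have "\<kappa> ^ (k - 1) * ((\<kappa> * (\<rho>\<^sup>2 * (v k)\<^sup>2 + (H k)\<^sup>2)) / D\<^sup>2) \<le>
            \<kappa> ^ (k - 1) * ((\<integral>z. (v k * s * z\<^sup>2 + H k)\<^sup>2 / (1 + A * z\<^sup>2)\<^sup>2 \<partial>\<nu>) / D\<^sup>2)"
          using kap by (intro mult_left_mono divide_right_mono) auto
        moreover have "\<kappa> ^ k = \<kappa> ^ (k - 1) * \<kappa>" using k by (metis atLeastAtMost_iff le_add_diff_inverse2 power_add power_one_right)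
        ultimately show ?thesis unfolding q_def H_def by (simp add: add_divide_distrib power_divide algebra_simps)
      qed
      \<comment> \<open>The term \<open>q 1\<close> is \<open>g^2\<close>, paid for by the gain of
        the norm; the end term \<open>q (Suc p)\<close> is \<open>(v 0)^2 / D^2\<close> and supplies
        the coordinate that no shift produces.\<close>
      have tele: "(\<Sum>k\<in>{1..p}. \<kappa> ^ k * q (Suc k)) = (\<Sum>k\<in>{1..p}. \<kappa> ^ (k - 1) * q k) - q 1 + \<kappa> ^ p * q (Suc p)" for p :: nat
        by (induction p) (simp_all add: algebra_simps)
      \<comment> \<open>\<open>cs\<close> lies below \<open>\<kappa> ^ k * \<rho>^2\<close> for
        every \<open>k \<le> p\<close> and below \<open>\<kappa> ^ p\<close>, so one constant serves
        all coordinates.\<close>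
      have "cs * (S / D\<^sup>2) + (\<Sum>k\<in>{1..p}. \<kappa> ^ (k - 1) * q k) - q 1
         \<le> (\<Sum>k\<in>{1..p}. \<kappa> ^ k * \<rho>\<^sup>2 * ((v k)\<^sup>2 / D\<^sup>2) + \<kappa> ^ k * q (Suc k))"
      proof -
        have "cs * (S / D\<^sup>2) = cs * ((v 0)\<^sup>2 / D\<^sup>2) + (\<Sum>k\<in>{1..p}. cs * ((v k)\<^sup>2 / D\<^sup>2))"
          unfolding S_def sq_norm_def atMost_split
          by (simp add: add_divide_distrib distrib_left sum_divide_distrib sum_distrib_left)
        moreover have "cs * ((v 0)\<^sup>2 / D\<^sup>2) \<le> \<kappa> ^ p * q (Suc p)"
        proof -
          have "cs \<le> \<kappa> ^ p * 1" unfolding cs_def using rho kap by (intro mult_left_mono) (auto simp: power_le_one)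
          then show ?thesis unfolding q_def tail_form_end power_divide by (intro mult_right_mono) auto
        qed
        moreover have "(\<Sum>k\<in>{1..p}. cs * ((v k)\<^sup>2 / D\<^sup>2)) \<le> (\<Sum>k\<in>{1..p}. \<kappa> ^ k * \<rho>\<^sup>2 * ((v k)\<^sup>2 / D\<^sup>2))"
          unfolding cs_def using kap by (intro sum_mono mult_right_mono power_decreasing) auto
        ultimately show ?thesis unfolding sum.distrib tele by linarith
      qed
      also have "\<dots> \<le> (\<Sum>k\<in>{1..p}. \<kappa> ^ (k - 1) * ((\<integral>z. (v k * s * z\<^sup>2 + H k)\<^sup>2 / (1 + A * z\<^sup>2)\<^sup>2 \<partial>\<nu>) / D\<^sup>2))"
        using G by (rule sum_mono)
      finally have cgq: "cs * (S / D\<^sup>2) + (\<Sum>k\<in>{1..p}. \<kappa> ^ (k - 1) * q k) - q 1 \<le> \<dots>" .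
      define GG where "GG = (\<Sum>k\<in>{1..p}. \<kappa> ^ (k - 1) * ((\<integral>z. (v k * s * z\<^sup>2 + H k)\<^sup>2 / (1 + A * z\<^sup>2)\<^sup>2 \<partial>\<nu>) / D\<^sup>2))"
      define QQ where "QQ = (\<Sum>k\<in>{1..p}. \<kappa> ^ (k - 1) * q k)"
      define T where "T = l\<^sup>2 * ((7 + 4 * p) * (1 + A\<^sup>2 + Bm\<^sup>2) * (1 + S) * D) * m"
      define SD where "SD = S * D"
      define V where "V = wsum p w y"
      define W where "W = b - e * D"
      define Y where "Y = S / D\<^sup>2"
      have SD0: "0 \<le> SD" unfolding SD_def using S0 D1 by simp
      have "l * (cs * Y + QQ - g\<^sup>2) \<le> l * GG"
        using cgq l unfolding Y_def QQ_def GG_def q_def[of 1] g_def by (intro mult_left_mono) auto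
      then have f1: "l * cs * Y + l * QQ - l * g\<^sup>2 \<le> l * GG" by (simp add: algebra_simps)
      have "l * \<mu> * S * (s + V0) \<le> l * \<mu> * S * (V + W)"
        using sV l mu S0 unfolding V_def W_def by (intro mult_left_mono) auto
      then have f2: "l * \<mu> * S * (s + V0) \<le> l * \<mu> * S * V + l * \<mu> * S * W" by (simp only: distrib_left)
      have "l * S * (- cs / D\<^sup>2 + \<mu> * W) \<le> l * S * (- \<gamma> * D)"
        using key[OF D1] l S0 unfolding W_def by (intro mult_left_mono) auto
      then have f3: "l * \<mu> * S * W \<le> l * cs * Y - l * \<gamma> * SD"
        unfolding Y_def SD_def by (simp add: algebra_simps)
      have "l * L \<le> \<gamma> / (2 * L + 1) * L" using l L0 unfolding l0_def by (intro mult_right_mono) auto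
      also have "\<dots> \<le> \<gamma> / 2" using L0 gam by (simp add: field_simps)
      finally have "l * (l * L) * SD \<le> l * (\<gamma> / 2) * SD" using l SD0 by (intro mult_right_mono mult_left_mono) auto
      moreover have "T = l\<^sup>2 * L * D + l * (l * L) * SD"
        unfolding T_def L_def SD_def by (simp add: power2_eq_square algebra_simps)
      ultimately have f4: "T \<le> l\<^sup>2 * L * D + l * \<gamma> * SD / 2" by simp
      have "c * l * lyap p \<kappa> \<mu> l w v y \<le> c * l * SD"
        unfolding SD_def S_def D_def using y0 ynn l l1 mu kap w gam
        by (intro mult_left_mono lyap_le) (auto simp: c_def)
      then have f5: "c * l * lyap p \<kappa> \<mu> l w v y \<le> l * \<gamma> * SD / 2" unfolding c_def by (simp add: mult_ac)
      have f6: "lyap p \<kappa> \<mu> l w v y = S + l * \<mu> * S * V - l * QQ"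
        unfolding lyap_def QQ_def q_def D_def S_def V_def by (simp add: algebra_simps)
      have f7: "0 \<le> l * g\<^sup>2" using l by simp
      have "S - 3/2 * l * g\<^sup>2 + 2 * l * B\<^sup>2 + l * \<mu> * S * (s + V0) + T - l * GG
          \<le> lyap p \<kappa> \<mu> l w v y - c * l * lyap p \<kappa> \<mu> l w v y + 2 * l * B\<^sup>2 + l\<^sup>2 * L * D"
        using f1 f2 f3 f4 f5 f7 unfolding f6 by linarith
      then show ?thesis unfolding T_def GG_def by (simp only: left_diff_distrib mult_1)
    qed
    finally have fin: "integral\<^sup>L \<nu> U \<le> (1 - c * l) * lyap p \<kappa> \<mu> l w v y + 2 * l * B\<^sup>2 + l\<^sup>2 * L * D" .
    have "(\<integral>\<^sup>+z. ennreal (F z) \<partial>\<nu>) \<le> (\<integral>\<^sup>+z. ennreal (U z) \<partial>\<nu>)"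
      using FU by (intro nn_integral_mono ennreal_leI)
    also have "\<dots> = ennreal (integral\<^sup>L \<nu> U)"
      using Uint order_trans[OF F0 FU] by (intro nn_integral_eq_integral) auto
    also have "\<dots> \<le> ennreal ((1 - c * l) * lyap p \<kappa> \<mu> l w v y + 2 * l * B\<^sup>2 + l\<^sup>2 * L * D)"
      using fin by (rule ennreal_leI)
    finally show ?case
      unfolding F_def s_def D_def .
  qed (use kap mu gam L0 l0 l01 l0p in \<open>auto simp: c_def\<close>)
qed

end

section \<open>Expectations along the process\<close>

text \<open>The generator is written as in the causality hypothesis of the theorem, which therefore
  is measurability with respect to \<open>past\<close>.\<close>

definition past :: "'s measure \<Rightarrow> (int \<Rightarrow> 's \<Rightarrow> real) \<Rightarrow> int \<Rightarrow> 's measure" where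
  "past M Z t = sigma (space M) (\<Union>s\<in>{..t}. {Z s -` A \<inter> space M | A. A \<in> sets borel})"

lemma space_past [simp]: "space (past M Z t) = space M"
  unfolding past_def by (rule space_measure_of) auto

lemma sets_past: "sets (past M Z t) = sigma_sets (space M) (\<Union>s\<in>{..t}. {Z s -` A \<inter> space M | A. A \<in> sets borel})"
  unfolding past_def by (rule sets_measure_of) auto

lemma measurable_past_mono:
  assumes "s \<le> t" "f \<in> borel_measurable (past M Z s)"
  shows "f \<in> borel_measurable (past M Z t)"
proof -
  have "sets (past M Z s) \<subseteq> sets (past M Z t)"
    unfolding sets_past using assms(1) by (intro sigma_sets_mono') fastforce
  then show ?thesis using assms(2) by (auto simp: measurable_def)
qed

context prob_space
begin

text \<open>Independence is grouped along the disjoint index sets \<open>{..t}\<close> and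
  \<open>{s}\<close>; the generators are closed under intersection, so it passes to the generated
  sigma-algebras. The identity map into \<open>past M Z t\<close> represents the whole past as one
  random element, and the product law is checked on rectangles.\<close>

lemma distr_past_pair:
  assumes indep: "indep_vars (\<lambda>_. borel) Z UNIV" and ts: "t < s"
  shows "(\<lambda>\<omega>. \<omega>) \<in> measurable M (past M Z t)"
    and "distr M (past M Z t) (\<lambda>\<omega>. \<omega>) \<Otimes>\<^sub>M distr M borel (Z s) = distr M (past M Z t \<Otimes>\<^sub>M borel) (\<lambda>\<omega>. (\<omega>, Z s \<omega>))"
proof -
  let ?E = "\<lambda>i. {Z i -` A \<inter> space M | A. A \<in> sets borel}"
  let ?I = "case_bool {..t} {s}"
  have Z: "random_variable borel (Z i)" for i
    using indep by (auto simp: indep_vars_def)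
  have "indep_sets (\<lambda>j. sigma_sets (space M) (\<Union>i\<in>?I j. ?E i)) UNIV"
  proof (rule indep_sets_collect_sigma)
    show "indep_sets ?E (\<Union>j\<in>UNIV. ?I j)"
      using indep unfolding indep_vars_def2 by (auto intro: indep_sets_mono_index)
    show "Int_stable (?E i)" for i
      unfolding Int_stable_def
    proof safe
      fix A B :: "real set" assume "A \<in> sets borel" "B \<in> sets borel"
      then show "\<exists>C. Z i -` A \<inter> space M \<inter> (Z i -` B \<inter> space M) = Z i -` C \<inter> space M \<and> C \<in> sets borel"
        by (intro exI[of _ "A \<inter> B"]) auto
    qed
    show "disjoint_family ?I"
      using ts unfolding disjoint_family_on_def by (auto split: bool.split)
  qed
  then have ind: "indep_set (sets (past M Z t)) (sigma_sets (space M) (?E s))"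
    unfolding indep_set_def sets_past by (rule indep_sets_mono_sets) (simp split: bool.split)
  then have sub: "sets (past M Z t) \<subseteq> events"
    by (simp add: indep_sets2_eq)
  show id [measurable]: "(\<lambda>\<omega>. \<omega>) \<in> measurable M (past M Z t)"
    using sub sets.sets_into_space[of _ "past M Z t"] by (intro measurableI) (auto simp: Int_absorb2)
  have [measurable]: "Z s \<in> borel_measurable M" by (rule Z)
  interpret P: prob_space "distr M (past M Z t) (\<lambda>\<omega>. \<omega>)" by (rule prob_space_distr) simp
  interpret D: prob_space "distr M borel (Z s)" by (rule prob_space_distr) simp
  show "distr M (past M Z t) (\<lambda>\<omega>. \<omega>) \<Otimes>\<^sub>M distr M borel (Z s) = distr M (past M Z t \<Otimes>\<^sub>M borel) (\<lambda>\<omega>. (\<omega>, Z s \<omega>))"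
  proof (rule pair_measure_eqI)
    fix A B assume A: "A \<in> sets (distr M (past M Z t) (\<lambda>\<omega>. \<omega>))" and B: "B \<in> sets (distr M borel (Z s))"
    then have [measurable]: "A \<in> sets (past M Z t)" "B \<in> sets borel" by auto
    have AM: "A \<in> events" using A sub by auto
    have As: "A \<inter> space M = A" using sets.sets_into_space[OF AM] by blast
    have "Z s -` B \<inter> space M \<in> sigma_sets (space M) (?E s)"
      using B by (intro sigma_sets.Basic) auto
    moreover have "A \<in> sets (past M Z t)" using A by simp
    ultimately have "prob (A \<inter> (Z s -` B \<inter> space M)) = prob A * prob (Z s -` B \<inter> space M)"
      using ind unfolding indep_sets2_eq by blast
    moreover have "(\<lambda>\<omega>. (\<omega>, Z s \<omega>)) -` (A \<times> B) \<inter> space M = A \<inter> (Z s -` B \<inter> space M)"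
      using As by auto
    ultimately show "emeasure (distr M (past M Z t) (\<lambda>\<omega>. \<omega>)) A * emeasure (distr M borel (Z s)) B =
        emeasure (distr M (past M Z t \<Otimes>\<^sub>M borel) (\<lambda>\<omega>. (\<omega>, Z s \<omega>))) (A \<times> B)"
      by (simp add: emeasure_distr As emeasure_eq_measure ennreal_mult')
  qed (simp_all add: P.sigma_finite_measure_axioms D.sigma_finite_measure_axioms cong: sets_pair_measure_cong)
qed

text \<open>Tonelli for the product law: the past is frozen while the independent noise variable is
  integrated out. This takes the place of conditional expectations.\<close>

lemma nn_integral_past_indep:
  assumes indep: "indep_vars (\<lambda>_. borel) Z UNIV" and ts: "t < s"
    and f: "case_prod f \<in> borel_measurable (past M Z t \<Otimes>\<^sub>M borel)"
  shows "(\<integral>\<^sup>+\<omega>. f \<omega> (Z s \<omega>) \<partial>M) = (\<integral>\<^sup>+\<omega>. (\<integral>\<^sup>+z. f \<omega> z \<partial>distr M borel (Z s)) \<partial>M)"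
proof -
  note id = distr_past_pair(1)[OF indep ts]
  have Z [measurable]: "Z s \<in> borel_measurable M" using indep by (auto simp: indep_vars_def)
  interpret D: prob_space "distr M borel (Z s)" by (rule prob_space_distr) simp
  have pair: "(\<lambda>\<omega>. (\<omega>, Z s \<omega>)) \<in> measurable M (past M Z t \<Otimes>\<^sub>M borel)"
    using id Z by (intro measurable_Pair) auto
  have f': "case_prod f \<in> borel_measurable (past M Z t \<Otimes>\<^sub>M distr M borel (Z s))"
    using f by (simp cong: measurable_cong_sets)
  have "(\<integral>\<^sup>+\<omega>. f \<omega> (Z s \<omega>) \<partial>M) = (\<integral>\<^sup>+x. case_prod f x \<partial>distr M (past M Z t \<Otimes>\<^sub>M borel) (\<lambda>\<omega>. (\<omega>, Z s \<omega>)))"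
    using f by (subst nn_integral_distr[OF pair]) auto
  also have "distr M (past M Z t \<Otimes>\<^sub>M borel) (\<lambda>\<omega>. (\<omega>, Z s \<omega>)) = distr M (past M Z t) (\<lambda>\<omega>. \<omega>) \<Otimes>\<^sub>M distr M borel (Z s)"
    by (rule distr_past_pair(2)[OF indep ts, symmetric])
  also have "(\<integral>\<^sup>+x. case_prod f x \<partial>(distr M (past M Z t) (\<lambda>\<omega>. \<omega>) \<Otimes>\<^sub>M distr M borel (Z s)))
      = (\<integral>\<^sup>+\<omega>. \<integral>\<^sup>+z. case_prod f (\<omega>, z) \<partial>distr M borel (Z s) \<partial>distr M (past M Z t) (\<lambda>\<omega>. \<omega>))"
    using f by (intro D.nn_integral_fst[symmetric]) (simp cong: measurable_cong_sets)
  also have "\<dots> = (\<integral>\<^sup>+\<omega>. (\<integral>\<^sup>+z. f \<omega> z \<partial>distr M borel (Z s)) \<partial>M)"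
    using D.borel_measurable_nn_integral_fst[OF f'] id by (subst nn_integral_distr) auto
  finally show ?thesis .
qed

end

lemma ennreal_add_sum:
  assumes "0 \<le> c" "\<And>j. j \<in> J \<Longrightarrow> 0 \<le> f j"
  shows "ennreal (c + sum f J) = ennreal c + (\<Sum>j\<in>J. ennreal (f j))"
  using assms by (simp add: sum_nonneg sum_ennreal)

section \<open>The time-varying ARCH process: second moments, measurability and the step in
  expectation\<close>

locale arch_process = prob_space M for M :: "'s measure" +
  fixes Z X :: "int \<Rightarrow> 's \<Rightarrow> real" and \<nu> :: "real measure" and p :: nat and n :: int and b :: "nat \<Rightarrow> int \<Rightarrow> real"
  assumes p: "p \<ge> 1"
    and Z_indep: "indep_vars (\<lambda>_. borel) Z UNIV"
    and Z_distr: "distr M borel (Z t) = \<nu>"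
    and X_adapted: "t \<le> n \<Longrightarrow> X t \<in> borel_measurable (past M Z t)"
    and X_meas: "t \<le> n \<Longrightarrow> X t \<in> borel_measurable M"
    and b_nonneg: "j \<le> p \<Longrightarrow> t \<le> n \<Longrightarrow> 0 \<le> b j t"
    and X_sq: "t \<le> n \<Longrightarrow> \<omega> \<in> space M \<Longrightarrow> (X t \<omega>)\<^sup>2 = (b 0 t + (\<Sum>j\<in>{1..p}. b j t * (X (t - int j) \<omega>)\<^sup>2)) * (Z t \<omega>)\<^sup>2"
    and noise_sq: "(\<integral>\<^sup>+z. ennreal (z\<^sup>2) \<partial>\<nu>) = 1"
begin

lemma X_adapted_past: "s \<le> t \<Longrightarrow> s \<le> n \<Longrightarrow> X s \<in> borel_measurable (past M Z t)"
  by (rule measurable_past_mono[OF _ X_adapted])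

text \<open>With the past frozen, the squared noise has mean 1 and the variance equation passes to
  the means.\<close>

lemma second_moment_rec:
  assumes "t \<le> n"
  shows "(\<integral>\<^sup>+\<omega>. ennreal ((X t \<omega>)\<^sup>2) \<partial>M) =
    ennreal (b 0 t) + (\<Sum>j\<in>{1..p}. ennreal (b j t) * (\<integral>\<^sup>+\<omega>. ennreal ((X (t - int j) \<omega>)\<^sup>2) \<partial>M))"
proof -
  define s where "s \<omega> = b 0 t + (\<Sum>j\<in>{1..p}. b j t * (X (t - int j) \<omega>)\<^sup>2)" for \<omega>
  have X_past: "X (t - int j) \<in> borel_measurable (past M Z (t - 1))" if "j \<in> {1..p}" for j
    using assms that by (intro X_adapted_past) auto
  have X_M: "X (t - int j) \<in> borel_measurable M" if "j \<in> {1..p}" for j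
    using assms that by (intro X_meas) auto
  have s0: "0 \<le> s \<omega>" for \<omega> unfolding s_def using b_nonneg assms by (intro add_nonneg_nonneg sum_nonneg) auto
  have s_meas [measurable]: "s \<in> borel_measurable (past M Z (t - 1))"
    unfolding s_def by (intro borel_measurable_add borel_measurable_sum borel_measurable_times borel_measurable_power X_past) auto
  have "(\<integral>\<^sup>+\<omega>. ennreal ((X t \<omega>)\<^sup>2) \<partial>M) = (\<integral>\<^sup>+\<omega>. ennreal (s \<omega> * (Z t \<omega>)\<^sup>2) \<partial>M)"
    by (intro nn_integral_cong) (simp add: X_sq assms s_def)
  also have "\<dots> = (\<integral>\<^sup>+\<omega>. (\<integral>\<^sup>+z. ennreal (s \<omega> * z\<^sup>2) \<partial>\<nu>) \<partial>M)"
    unfolding Z_distr[of t, symmetric] by (rule nn_integral_past_indep[OF Z_indep, of "t - 1"]) (auto, measurable)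
  also have "\<dots> = (\<integral>\<^sup>+\<omega>. ennreal (s \<omega>) \<partial>M)"
  proof (rule nn_integral_cong)
    fix \<omega>
    have [measurable_cong]: "sets \<nu> = sets borel" unfolding Z_distr[of t, symmetric] by simp
    have "(\<integral>\<^sup>+z. ennreal (s \<omega> * z\<^sup>2) \<partial>\<nu>) = (\<integral>\<^sup>+z. ennreal (s \<omega>) * ennreal (z\<^sup>2) \<partial>\<nu>)"
      using s0 by (simp add: ennreal_mult)
    also have "\<dots> = ennreal (s \<omega>) * (\<integral>\<^sup>+z. ennreal (z\<^sup>2) \<partial>\<nu>)"
      by (rule nn_integral_cmult) measurable
    finally show "(\<integral>\<^sup>+z. ennreal (s \<omega> * z\<^sup>2) \<partial>\<nu>) = ennreal (s \<omega>)" by (simp add: noise_sq)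
  qed
  also have "\<dots> = (\<integral>\<^sup>+\<omega>. ennreal (b 0 t) + (\<Sum>j\<in>{1..p}. ennreal (b j t) * ennreal ((X (t - int j) \<omega>)\<^sup>2)) \<partial>M)"
    unfolding s_def using b_nonneg assms
    by (intro nn_integral_cong) (subst ennreal_add_sum, auto simp: ennreal_mult)
  also have "\<dots> = ennreal (b 0 t) + (\<Sum>j\<in>{1..p}. ennreal (b j t) * (\<integral>\<^sup>+\<omega>. ennreal ((X (t - int j) \<omega>)\<^sup>2) \<partial>M))"
  proof -
    have "(\<integral>\<^sup>+\<omega>. (\<Sum>j\<in>{1..p}. ennreal (b j t) * ennreal ((X (t - int j) \<omega>)\<^sup>2)) \<partial>M)
        = (\<Sum>j\<in>{1..p}. \<integral>\<^sup>+\<omega>. ennreal (b j t) * ennreal ((X (t - int j) \<omega>)\<^sup>2) \<partial>M)"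
      by (rule nn_integral_sum) (use X_M in measurable)
    also have "\<dots> = (\<Sum>j\<in>{1..p}. ennreal (b j t) * (\<integral>\<^sup>+\<omega>. ennreal ((X (t - int j) \<omega>)\<^sup>2) \<partial>M))"
      by (intro sum.cong nn_integral_cmult refl) (use X_M in measurable)
    finally show ?thesis
      using X_M by (subst nn_integral_add) (auto simp: emeasure_space_1)
  qed
  finally show ?thesis .
qed

text \<open>The supremum \<open>S\<close> of the second moments satisfies
  \<open>S \<le> A + (1 - \<eta>) S\<close>. The a priori bound \<open>B\<close> only makes
  \<open>S\<close> finite, so that it may be subtracted; the resulting bound no longer contains it,
  nor \<open>n\<close>.\<close>

lemma second_moment_bound:
  assumes b0: "\<And>t. t \<le> n \<Longrightarrow> b 0 t \<le> A" and bs: "\<And>t. t \<le> n \<Longrightarrow> (\<Sum>j\<in>{1..p}. b j t) \<le> 1 - \<eta>" and eta: "0 < \<eta>"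
    and fin: "\<And>t. t \<le> n \<Longrightarrow> (\<integral>\<^sup>+\<omega>. ennreal ((X t \<omega>)\<^sup>2) \<partial>M) \<le> ennreal B"
    and t: "t \<le> n"
  shows "(\<integral>\<^sup>+\<omega>. ennreal ((X t \<omega>)\<^sup>2) \<partial>M) \<le> ennreal (A / \<eta>)"
proof -
  define m where "m t = enn2real (\<integral>\<^sup>+\<omega>. ennreal ((X t \<omega>)\<^sup>2) \<partial>M)" for t
  have m: "(\<integral>\<^sup>+\<omega>. ennreal ((X t \<omega>)\<^sup>2) \<partial>M) = ennreal (m t)" if "t \<le> n" for t
    unfolding m_def using fin[OF that] by (intro ennreal_enn2real[symmetric]) (auto simp: less_top[symmetric] top_unique)
  have m0: "0 \<le> m t" for t unfolding m_def by simp
  have mB: "m t \<le> max 0 B" if "t \<le> n" for t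
  proof -
    have "ennreal (m t) \<le> ennreal B" using m[OF that] fin[OF that] by simp
    also have "\<dots> \<le> ennreal (max 0 B)" by (intro ennreal_leI) simp
    finally show ?thesis by (subst (asm) ennreal_le_iff) auto
  qed
  define S where "S = Sup (m ` {..n})"
  have bdd: "bdd_above (m ` {..n})" using mB by (intro bdd_aboveI2) auto
  have mS: "m t \<le> S" if "t \<le> n" for t unfolding S_def using bdd that by (intro cSup_upper) auto
  have S0: "0 \<le> S" using mS[OF t] m0[of t] by linarith
  have rec: "m t = b 0 t + (\<Sum>j\<in>{1..p}. b j t * m (t - int j))" if "t \<le> n" for t
  proof -
    have "ennreal (m t) = ennreal (b 0 t) + (\<Sum>j\<in>{1..p}. ennreal (b j t) * ennreal (m (t - int j)))"
      using that by (simp add: m[symmetric] second_moment_rec)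
    also have "\<dots> = ennreal (b 0 t + (\<Sum>j\<in>{1..p}. b j t * m (t - int j)))"
      using b_nonneg that m0 by (subst ennreal_add_sum) (auto simp: ennreal_mult)
    finally show ?thesis
      using b_nonneg that m0 by (subst (asm) ennreal_inj) (auto intro!: add_nonneg_nonneg sum_nonneg)
  qed
  have "m t \<le> A + (1 - \<eta>) * S" if "t \<le> n" for t
  proof -
    have "(\<Sum>j\<in>{1..p}. b j t * m (t - int j)) \<le> (\<Sum>j\<in>{1..p}. b j t * S)"
      using that b_nonneg mS by (intro sum_mono mult_left_mono) auto
    also have "\<dots> = (\<Sum>j\<in>{1..p}. b j t) * S" by (simp add: sum_distrib_right)
    also have "\<dots> \<le> (1 - \<eta>) * S" using bs[OF that] S0 by (intro mult_right_mono) auto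
    finally show ?thesis using rec[OF that] b0[OF that] by linarith
  qed
  then have "S \<le> A + (1 - \<eta>) * S" unfolding S_def by (intro cSup_least) auto
  then have "S \<le> A / \<eta>" using eta by (simp add: field_simps)
  then show ?thesis using m[OF t] mS[OF t] by (simp add: ennreal_leI)
qed

definition regr :: "nat \<Rightarrow> 's \<Rightarrow> nat \<Rightarrow> real" where
  "regr t \<omega> = calX p (\<lambda>s. X s \<omega>) t"

definition est_err :: "real \<Rightarrow> (nat \<Rightarrow> real) \<Rightarrow> nat \<Rightarrow> 's \<Rightarrow> nat \<Rightarrow> real" where
  "est_err l \<alpha> t \<omega> i = anre l p (\<lambda>s. X s \<omega>) t i - \<alpha> i"

lemma regr_0: "regr t \<omega> 0 = 1"
  by (simp add: regr_def calX_def)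

lemma regr_nonneg: "0 \<le> regr t \<omega> i"
  by (simp add: regr_def calX_def)

lemma measurable_regr:
  assumes "int t \<le> n"
  shows "(\<lambda>\<omega>. regr t \<omega> i) \<in> borel_measurable (past M Z (int t))"
proof (cases "i = 0 \<or> i > p")
  case False
  then have "X (int t - int i + 1) \<in> borel_measurable (past M Z (int t))"
    using assms by (intro X_adapted_past) auto
  with False show ?thesis by (simp add: regr_def calX_def)
qed (auto simp: regr_def calX_def)

lemma measurable_anre:
  assumes "int t \<le> n"
  shows "(\<lambda>\<omega>. anre l p (\<lambda>s. X s \<omega>) t i) \<in> borel_measurable (past M Z (int t))"
  using assms
proof (induction t arbitrary: i)
  case (Suc t)
  have [measurable]: "(\<lambda>\<omega>. anre l p (\<lambda>s. X s \<omega>) t i) \<in> borel_measurable (past M Z (int (Suc t)))" for i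
    using Suc by (intro measurable_past_mono[OF _ Suc.IH]) auto
  have [measurable]: "(\<lambda>\<omega>. calX p (\<lambda>s. X s \<omega>) t i) \<in> borel_measurable (past M Z (int (Suc t)))" for i
    using Suc.prems measurable_past_mono[OF _ measurable_regr[of t i]] by (auto simp: regr_def)
  have [measurable]: "X (int (Suc t)) \<in> borel_measurable (past M Z (int (Suc t)))"
    using Suc.prems by (rule X_adapted)
  show ?case
    by (cases "Suc t \<le> p") (simp_all add: norm1_def del: of_nat_Suc)
qed simp

lemma measurable_est_err:
  assumes "int t \<le> n"
  shows "(\<lambda>\<omega>. est_err l \<alpha> t \<omega> i) \<in> borel_measurable (past M Z (int t))"
  unfolding est_err_def using measurable_anre[OF assms] by measurable

lemma measurable_past_M:
  assumes "f \<in> borel_measurable (past M Z t)"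
  shows "f \<in> borel_measurable M"
  using measurable_compose[OF distr_past_pair(1)[OF Z_indep, of t "t + 1"] assms] by simp

lemma X_sq_regr:
  assumes "int (Suc t) \<le> n" "\<omega> \<in> space M"
  shows "(X (int (Suc t)) \<omega>)\<^sup>2 = (\<Sum>i\<le>p. b i (int (Suc t)) * regr t \<omega> i) * (Z (int (Suc t)) \<omega>)\<^sup>2"
proof -
  have "(\<Sum>j\<in>{1..p}. b j (int (Suc t)) * (X (int (Suc t) - int j) \<omega>)\<^sup>2) = (\<Sum>j\<in>{1..p}. b j (int (Suc t)) * regr t \<omega> j)"
    by (intro sum.cong) (auto simp: regr_def calX_def algebra_simps)
  then show ?thesis unfolding X_sq[OF assms] atMost_split by (simp add: regr_0)
qed

lemma regr_Suc:
  assumes "int (Suc t) \<le> n" "\<omega> \<in> space M"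
  shows "regr (Suc t) \<omega> = shift_in p ((\<Sum>i\<le>p. b i (int (Suc t)) * regr t \<omega> i) * (Z (int (Suc t)) \<omega>)\<^sup>2) (regr t \<omega>)"
  unfolding X_sq_regr[OF assms, symmetric]
  using p by (intro ext) (auto simp: regr_def calX_def shift_in_def algebra_simps of_nat_diff)

lemma est_err_Suc:
  assumes "int (Suc t) \<le> n" "\<omega> \<in> space M" "p \<le> t"
  shows "est_err l \<alpha> (Suc t) \<omega> = nlms p l \<alpha> (est_err l \<alpha> t \<omega>) (regr t \<omega>)
    ((\<Sum>i\<le>p. b i (int (Suc t)) * regr t \<omega> i) * (Z (int (Suc t)) \<omega>)\<^sup>2)"
  unfolding X_sq_regr[OF assms(1,2), symmetric] using assms(3)
  by (intro ext) (simp add: est_err_def nlms_def regr_def)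

lemma nn_integral_norm1_regr:
  fixes m :: real
  assumes "int t \<le> n" "\<And>s. s \<le> n \<Longrightarrow> (\<integral>\<^sup>+\<omega>. ennreal ((X s \<omega>)\<^sup>2) \<partial>M) \<le> ennreal m" "0 \<le> m"
  shows "(\<integral>\<^sup>+\<omega>. ennreal (norm1 p (regr t \<omega>)) \<partial>M) \<le> ennreal (1 + p * m)"
proof -
  have "(\<integral>\<^sup>+\<omega>. ennreal (norm1 p (regr t \<omega>)) \<partial>M) = (\<integral>\<^sup>+\<omega>. 1 + (\<Sum>i\<in>{1..p}. ennreal (regr t \<omega> i)) \<partial>M)"
    by (intro nn_integral_cong) (simp add: norm1_nonneg_eq regr_nonneg atMost_split regr_0 sum_nonneg sum_ennreal)
  also have "\<dots> = 1 + (\<Sum>i\<in>{1..p}. (\<integral>\<^sup>+\<omega>. ennreal (regr t \<omega> i) \<partial>M))"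
  proof -
    have [measurable]: "(\<lambda>\<omega>. regr t \<omega> i) \<in> borel_measurable M" for i
      by (rule measurable_past_M[OF measurable_regr[OF assms(1)]])
    show ?thesis by (simp add: nn_integral_add nn_integral_sum emeasure_space_1)
  qed
  also have "\<dots> \<le> 1 + (\<Sum>i\<in>{1..p}. ennreal m)"
  proof (intro add_left_mono sum_mono)
    fix i assume "i \<in> {1..p}"
    then have "(\<integral>\<^sup>+\<omega>. ennreal (regr t \<omega> i) \<partial>M) = (\<integral>\<^sup>+\<omega>. ennreal ((X (int t - int i + 1) \<omega>)\<^sup>2) \<partial>M)"
      by (simp add: regr_def calX_def)
    also have "\<dots> \<le> ennreal m" using \<open>i \<in> {1..p}\<close> assms(1) by (intro assms(2)) auto
    finally show "(\<integral>\<^sup>+\<omega>. ennreal (regr t \<omega> i) \<partial>M) \<le> ennreal m" .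
  qed
  also have "\<dots> = ennreal (1 + p * m)"
    using assms(3) by (simp add: ennreal_mult ennreal_of_nat_eq_real_of_nat)
  finally show ?thesis .
qed

text \<open>The drift for a frozen state is integrated over the past; the remaining factor
  \<open>norm1\<close> is replaced by its mean, which the uniform second moment bound
  controls.\<close>

lemma nn_integral_lyap_step:
  fixes m q E F :: real
  assumes t: "p \<le> t" "int (Suc t) \<le> n" and m: "\<And>s. s \<le> n \<Longrightarrow> (\<integral>\<^sup>+\<omega>. ennreal ((X s \<omega>)\<^sup>2) \<partial>M) \<le> ennreal m" "0 \<le> m"
    and q: "0 \<le> q" and E: "0 \<le> E" and F: "0 \<le> F"
    and pos: "\<And>v y. y 0 = 1 \<Longrightarrow> (\<And>i. i \<le> p \<Longrightarrow> 0 \<le> y i) \<Longrightarrow> 0 \<le> lyap p \<kappa> \<mu> l w v y"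
    and step: "\<And>v y. y 0 = 1 \<Longrightarrow> (\<And>i. i \<le> p \<Longrightarrow> 0 \<le> y i) \<Longrightarrow>
      (\<integral>\<^sup>+z. ennreal (lyap p \<kappa> \<mu> l w' (nlms p l \<alpha> v y ((\<Sum>i\<le>p. b i (int (Suc t)) * y i) * z\<^sup>2))
              (shift_in p ((\<Sum>i\<le>p. b i (int (Suc t)) * y i) * z\<^sup>2) y)) \<partial>\<nu>)
        \<le> ennreal (q * lyap p \<kappa> \<mu> l w v y + E + F * norm1 p y)"
  shows "(\<integral>\<^sup>+\<omega>. ennreal (lyap p \<kappa> \<mu> l w' (est_err l \<alpha> (Suc t) \<omega>) (regr (Suc t) \<omega>)) \<partial>M)
    \<le> ennreal q * (\<integral>\<^sup>+\<omega>. ennreal (lyap p \<kappa> \<mu> l w (est_err l \<alpha> t \<omega>) (regr t \<omega>)) \<partial>M) + ennreal (E + F * (1 + p * m))"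
proof -
  have tn: "int t \<le> n" using t by simp
  have regr_P: "(\<lambda>\<omega>. regr t \<omega> i) \<in> borel_measurable (past M Z (int t))" for i by (rule measurable_regr[OF tn])
  have err_P: "(\<lambda>\<omega>. est_err l \<alpha> t \<omega> i) \<in> borel_measurable (past M Z (int t))" for i by (rule measurable_est_err[OF tn])
  define f where "f \<omega> z = ennreal (lyap p \<kappa> \<mu> l w' (nlms p l \<alpha> (est_err l \<alpha> t \<omega>) (regr t \<omega>) ((\<Sum>i\<le>p. b i (int (Suc t)) * regr t \<omega> i) * z\<^sup>2))
              (shift_in p ((\<Sum>i\<le>p. b i (int (Suc t)) * regr t \<omega> i) * z\<^sup>2) (regr t \<omega>)))" for \<omega> z
  have f_meas: "case_prod f \<in> borel_measurable (past M Z (int t) \<Otimes>\<^sub>M borel)"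
  proof -
    note [measurable] = regr_P err_P
    have [measurable]: "(\<lambda>x. shift_in p (g x) (regr t (fst x)) i) \<in> borel_measurable (past M Z (int t) \<Otimes>\<^sub>M borel)"
      if [measurable]: "g \<in> borel_measurable (past M Z (int t) \<Otimes>\<^sub>M borel)" for g :: "'s \<times> real \<Rightarrow> real" and i
      unfolding shift_in_def by measurable
    show ?thesis
      unfolding f_def lyap_def sq_norm_def wsum_def tail_form_def nlms_def norm1_def case_prod_beta by measurable
  qed
  have "(\<integral>\<^sup>+\<omega>. ennreal (lyap p \<kappa> \<mu> l w' (est_err l \<alpha> (Suc t) \<omega>) (regr (Suc t) \<omega>)) \<partial>M) = (\<integral>\<^sup>+\<omega>. f \<omega> (Z (int (Suc t)) \<omega>) \<partial>M)"
    unfolding f_def using t by (intro nn_integral_cong) (simp only: regr_Suc est_err_Suc)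
  also have "\<dots> = (\<integral>\<^sup>+\<omega>. (\<integral>\<^sup>+z. f \<omega> z \<partial>\<nu>) \<partial>M)"
    unfolding Z_distr[of "int (Suc t)", symmetric]
    by (rule nn_integral_past_indep[OF Z_indep _ f_meas]) simp
  also have "\<dots> \<le> (\<integral>\<^sup>+\<omega>. ennreal (q * lyap p \<kappa> \<mu> l w (est_err l \<alpha> t \<omega>) (regr t \<omega>) + E + F * norm1 p (regr t \<omega>)) \<partial>M)"
    unfolding f_def by (intro nn_integral_mono step regr_0 regr_nonneg)
  also have "\<dots> = (\<integral>\<^sup>+\<omega>. ennreal q * ennreal (lyap p \<kappa> \<mu> l w (est_err l \<alpha> t \<omega>) (regr t \<omega>)) + (ennreal E + ennreal F * ennreal (norm1 p (regr t \<omega>))) \<partial>M)"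
  proof (rule nn_integral_cong)
    fix \<omega>
    have "0 \<le> lyap p \<kappa> \<mu> l w (est_err l \<alpha> t \<omega>) (regr t \<omega>)" by (intro pos regr_0 regr_nonneg)
    moreover have "0 \<le> norm1 p (regr t \<omega>)" unfolding norm1_def by (intro sum_nonneg) auto
    ultimately show "ennreal (q * lyap p \<kappa> \<mu> l w (est_err l \<alpha> t \<omega>) (regr t \<omega>) + E + F * norm1 p (regr t \<omega>)) =
      ennreal q * ennreal (lyap p \<kappa> \<mu> l w (est_err l \<alpha> t \<omega>) (regr t \<omega>)) + (ennreal E + ennreal F * ennreal (norm1 p (regr t \<omega>)))"
      using q E F by (simp add: ennreal_mult add.assoc)
  qed
  also have "\<dots> = ennreal q * (\<integral>\<^sup>+\<omega>. ennreal (lyap p \<kappa> \<mu> l w (est_err l \<alpha> t \<omega>) (regr t \<omega>)) \<partial>M)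
      + (ennreal E + ennreal F * (\<integral>\<^sup>+\<omega>. ennreal (norm1 p (regr t \<omega>)) \<partial>M))"
  proof -
    note [measurable] = measurable_past_M[OF regr_P] measurable_past_M[OF err_P]
    have [measurable]: "(\<lambda>\<omega>. lyap p \<kappa> \<mu> l w (est_err l \<alpha> t \<omega>) (regr t \<omega>)) \<in> borel_measurable M"
      unfolding lyap_def sq_norm_def wsum_def tail_form_def norm1_def by measurable
    have [measurable]: "(\<lambda>\<omega>. norm1 p (regr t \<omega>)) \<in> borel_measurable M" unfolding norm1_def by measurable
    show ?thesis by (simp add: nn_integral_add nn_integral_cmult emeasure_space_1)
  qed
  also have "\<dots> \<le> ennreal q * (\<integral>\<^sup>+\<omega>. ennreal (lyap p \<kappa> \<mu> l w (est_err l \<alpha> t \<omega>) (regr t \<omega>)) \<partial>M)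
      + (ennreal E + ennreal F * ennreal (1 + p * m))"
    using nn_integral_norm1_regr[OF tn m] by (intro add_left_mono mult_left_mono) auto
  also have "ennreal E + ennreal F * ennreal (1 + p * m) = ennreal (E + F * (1 + p * m))"
    using E F m(2) by (simp add: ennreal_mult distrib_left)
  finally show ?thesis .
qed

end

section \<open>Iterating the drift inequality\<close>

text \<open>From \<open>exp x \<ge> x^2 / 2\<close>. Quadratic decay suffices for the initial error,
  because the exponent \<open>2 \<beta>\<close> of the target rate is at most 2.\<close>

lemma one_minus_power_le_inverse_square:
  fixes y :: real
  assumes "0 \<le> y" "y \<le> 1" "0 < n * y"
  shows "(1 - y) ^ n \<le> 2 / (n * y)\<^sup>2"
proof -
  have "(1 - y) ^ n \<le> exp (- y) ^ n" using assms exp_ge_add_one_self[of "- y"] by (intro power_mono) auto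
  also have "\<dots> = inverse (exp (n * y))" by (simp add: exp_of_nat_mult[symmetric] exp_minus mult.commute flip: exp_minus)
  also have "\<dots> \<le> inverse ((n * y)\<^sup>2 / 2)"
  proof (rule le_imp_inverse_le)
    have "1 + n * y + (n * y)\<^sup>2 / 2 \<le> exp (n * y)" using assms by (intro exp_lower_Taylor_quadratic) auto
    then show "(n * y)\<^sup>2 / 2 \<le> exp (n * y)" using assms by linarith
    show "0 < (n * y)\<^sup>2 / 2" using zero_less_power[OF assms(3), of 2] by simp
  qed
  finally show ?thesis by (simp add: inverse_eq_divide)
qed

text \<open>The proof compares \<open>u\<close> with a supersolution that is quadratic in the rescaled distance \<open>(T - t) l\<close> to the
  final time.\<close>

lemma contraction_recursion:
  fixes u :: "nat \<Rightarrow> ennreal" and c l G k2 \<theta> :: real and T s :: nat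
  assumes c: "0 < c" "c \<le> 1" and l: "0 < l" "l \<le> 1" and G: "0 \<le> G" and k2: "0 \<le> k2" and \<theta>: "0 \<le> \<theta>"
    and init: "u s \<le> ennreal U" and U: "0 \<le> U" and sT: "s \<le> T"
    and rec: "\<And>t. s \<le> t \<Longrightarrow> t < T \<Longrightarrow>
       u (Suc t) \<le> ennreal (1 - c * l) * u t + ennreal (l * (k2 * \<theta> * (1 + (real (T - t) * l)\<^sup>2)) + l\<^sup>2 * G)"
  shows "u T \<le> ennreal ((1 - c * l) ^ (T - s) * U + l * (G / c) + \<theta> * (2 * k2 / c * (6 / c)\<^sup>2))"
proof -
  \<comment> \<open>\<open>c A = 2 k2\<close> lets half of the contraction of \<open>A Y^2\<close>
    pay for the source \<open>k2 Y^2\<close>. \<open>c B = 6\<close> gives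
    \<open>c Y \<ge> 4\<close>, so that the other half covers the loss \<open>2 A Y l\<close> when
    the quadratic moves one step towards the final time. At that time the quadratic has the value
    \<open>A B^2\<close>.\<close>
  define A where "A = 2 * k2 / c"
  define B where "B = 6 / c"
  define V where "V t = (1 - c * l) ^ (t - s) * U + l * (G / c) + \<theta> * (A * (real (T - t) * l + B)\<^sup>2)" for t
  have cl: "0 \<le> 1 - c * l" using c l mult_le_one[of c l] by simp
  have B6: "6 \<le> B" "c * B = 6" unfolding B_def using c by (auto simp: field_simps)
  have A0: "0 \<le> A" "c * A = 2 * k2" unfolding A_def using c k2 by auto
  have main: "t \<le> T \<Longrightarrow> u t \<le> ennreal (V t)" if "s \<le> t" for t
    using that
  proof (induction t rule: dec_induct)
    case base
    have "U \<le> V s" unfolding V_def using c l G \<theta> A0 by simp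
    then show ?case using init by (meson ennreal_leI order_trans)
  next
    case (step t)
    define x where "x = real (T - Suc t) * l"
    have Tt: "real (T - t) * l = x + l" using step by (simp add: x_def of_nat_diff algebra_simps)
    have x0: "0 \<le> x" unfolding x_def using l by simp
    have "u (Suc t) \<le> ennreal (1 - c * l) * ennreal (V t) + ennreal (l * (k2 * \<theta> * (1 + (x + l)\<^sup>2)) + l\<^sup>2 * G)"
    proof -
      have "u (Suc t) \<le> ennreal (1 - c * l) * u t + ennreal (l * (k2 * \<theta> * (1 + (x + l)\<^sup>2)) + l\<^sup>2 * G)"
        using rec[of t] step unfolding Tt by simp
      also have "\<dots> \<le> ennreal (1 - c * l) * ennreal (V t) + ennreal (l * (k2 * \<theta> * (1 + (x + l)\<^sup>2)) + l\<^sup>2 * G)"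
        using step by (intro add_right_mono mult_left_mono) auto
      finally show ?thesis .
    qed
    also have "\<dots> = ennreal ((1 - c * l) * V t + (l * (k2 * \<theta> * (1 + (x + l)\<^sup>2)) + l\<^sup>2 * G))"
      using cl l k2 \<theta> G A0 U c by (simp add: ennreal_mult V_def)
    also have "\<dots> \<le> ennreal (V (Suc t))"
    proof (rule ennreal_leI)
      define Y where "Y = x + l + B"
      have Y: "6 \<le> Y" "6 \<le> c * Y" unfolding Y_def using x0 l B6 c by (auto simp: distrib_left intro: order_trans[OF _ B6(1)])
      have "1 + (x + l)\<^sup>2 \<le> Y\<^sup>2"
      proof -
        have "Y\<^sup>2 = (x + l)\<^sup>2 + 2 * (x + l) * B + B\<^sup>2" unfolding Y_def by (simp add: power2_eq_square algebra_simps)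
        moreover have "0 \<le> 2 * (x + l) * B" using x0 l B6 by simp
        moreover have "1\<^sup>2 \<le> B\<^sup>2" using B6 by (intro power_mono) auto
        ultimately show ?thesis by simp
      qed
      then have b1: "k2 * (1 + (x + l)\<^sup>2) \<le> k2 * Y\<^sup>2" using k2 by (intro mult_left_mono) auto
      have b2: "A * (Y\<^sup>2 - l * (c * Y\<^sup>2 / 2)) \<le> A * (Y - l)\<^sup>2"
      proof (rule mult_left_mono)
        have "2 * Y \<le> c * Y * Y / 2" using mult_right_mono[OF Y(2), of Y] Y(1) by simp
        then have "l * (2 * Y) \<le> l * (c * Y\<^sup>2 / 2)" using l by (intro mult_left_mono) (auto simp: power2_eq_square)
        moreover have "(Y - l)\<^sup>2 = Y\<^sup>2 - l * (2 * Y) + l\<^sup>2" by (simp add: power2_diff)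
        moreover have "0 \<le> l\<^sup>2" by simp
        ultimately show "Y\<^sup>2 - l * (c * Y\<^sup>2 / 2) \<le> (Y - l)\<^sup>2" by linarith
      qed (rule A0)
      have "(1 - c * l) * (A * Y\<^sup>2) + l * (k2 * (1 + (x + l)\<^sup>2)) \<le> A * (Y - l)\<^sup>2"
      proof -
        have "l * (k2 * (1 + (x + l)\<^sup>2)) \<le> l * (k2 * Y\<^sup>2)" using mult_left_mono[OF b1, of l] l by simp
        also have "l * (k2 * Y\<^sup>2) = l * (c * A / 2 * Y\<^sup>2)" using A0 by simp
        finally have "(1 - c * l) * (A * Y\<^sup>2) + l * (k2 * (1 + (x + l)\<^sup>2)) \<le> (1 - c * l) * (A * Y\<^sup>2) + l * (c * A / 2 * Y\<^sup>2)" by simp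
        also have "\<dots> = A * (Y\<^sup>2 - l * (c * Y\<^sup>2 / 2))" by (simp add: algebra_simps)
        finally show ?thesis using b2 by linarith
      qed
      then have "\<theta> * ((1 - c * l) * (A * Y\<^sup>2) + l * (k2 * (1 + (x + l)\<^sup>2))) \<le> \<theta> * (A * (Y - l)\<^sup>2)"
        using \<theta> by (rule mult_left_mono)
      moreover have "(1 - c * l) * V t = (1 - c * l) ^ (Suc t - s) * U + (1 - c * l) * (l * (G / c)) + \<theta> * ((1 - c * l) * (A * Y\<^sup>2))"
        unfolding V_def Tt Y_def using step by (simp add: Suc_diff_le algebra_simps)
      \<comment> \<open>\<open>l * (G / c)\<close> is the fixed point of the recursion with source
        \<open>l^2 G\<close>.\<close>
      moreover have "(1 - c * l) * (l * (G / c)) + l\<^sup>2 * G = l * (G / c)"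
        using c by (simp add: power2_eq_square field_simps)
      moreover have "V (Suc t) = (1 - c * l) ^ (Suc t - s) * U + l * (G / c) + \<theta> * (A * (Y - l)\<^sup>2)"
        unfolding V_def Y_def x_def by (simp add: algebra_simps)
      ultimately show "(1 - c * l) * V t + (l * (k2 * \<theta> * (1 + (x + l)\<^sup>2)) + l\<^sup>2 * G) \<le> V (Suc t)"
        by (simp add: algebra_simps)
    qed
    finally show ?case .
  qed
  show ?thesis using main[OF sT] unfolding V_def A_def B_def by simp
qed

section \<open>Consequences of the assumptions\<close>

text \<open>The tangent of the convex power at 1, obtained from Young's inequality with second
  factor 1.\<close>

lemma powr_ge_tangent:
  fixes y r :: real
  assumes "0 \<le> y" "1 < r"
  shows "1 + r * (y - 1) \<le> y powr r"
proof (cases "y = 0")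
  case False
  then have "(y powr r) powr (1 / r) * 1 powr (1 - 1 / r) \<le> 1 / r * y powr r + (1 - 1 / r) * 1"
    using assms by (intro Youngs_inequality_0) auto
  then have "y \<le> 1 / r * y powr r + (1 - 1 / r)"
    using assms by (simp add: powr_powr)
  then have "r * y \<le> r * (1 / r * y powr r + (1 - 1 / r))"
    using assms by (intro mult_left_mono) auto
  also have "\<dots> = y powr r + r - 1" using assms by (simp add: field_simps)
  finally show ?thesis by (simp add: algebra_simps)
qed (use assms in simp)

text \<open>Integrating the tangent bound at the squared variable, whose mean is 1. It shows that
  the moment factor in A(r)(i) is at least 1.\<close>

lemma (in prob_space) moment_powr_ge_1:
  fixes f :: "'a \<Rightarrow> real"
  assumes "integrable M (\<lambda>\<omega>. (f \<omega>)\<^sup>2)" "(\<integral>\<omega>. (f \<omega>)\<^sup>2 \<partial>M) = 1" "integrable M (\<lambda>\<omega>. \<bar>f \<omega>\<bar> powr (2 * r))" "1 < r"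
  shows "1 \<le> (\<integral>\<omega>. \<bar>f \<omega>\<bar> powr (2 * r) \<partial>M)"
proof -
  have "1 = (\<integral>\<omega>. 1 + r * ((f \<omega>)\<^sup>2 - 1) \<partial>M)"
    using assms(1,2) by (simp add: prob_space)
  also have "\<dots> \<le> (\<integral>\<omega>. \<bar>f \<omega>\<bar> powr (2 * r) \<partial>M)"
  proof (rule integral_mono[OF _ assms(3)])
    show "integrable M (\<lambda>\<omega>. 1 + r * ((f \<omega>)\<^sup>2 - 1))" using assms(1) by simp
    fix \<omega>
    have "\<bar>f \<omega>\<bar> powr (2 * r) = (f \<omega>)\<^sup>2 powr r"
      by (cases "f \<omega> = 0") (simp_all add: powr_powr[symmetric] powr_numeral)
    then show "1 + r * ((f \<omega>)\<^sup>2 - 1) \<le> \<bar>f \<omega>\<bar> powr (2 * r)"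
      using powr_ge_tangent[of "(f \<omega>)\<^sup>2" r] assms(4) by simp
  qed
  finally show ?thesis .
qed

lemma (in prob_space) integrable_sixth_power:
  assumes [measurable]: "f \<in> borel_measurable M" and "integrable M (\<lambda>\<omega>. \<bar>f \<omega>\<bar> powr s)" "6 \<le> s"
  shows "integrable M (\<lambda>\<omega>. f \<omega> ^ 6 :: real)"
proof (rule Bochner_Integration.integrable_bound[where f = "\<lambda>\<omega>. 1 + \<bar>f \<omega>\<bar> powr s"])
  show "integrable M (\<lambda>\<omega>. 1 + \<bar>f \<omega>\<bar> powr s)" using assms by simp
  show "AE \<omega> in M. norm (f \<omega> ^ 6) \<le> norm (1 + \<bar>f \<omega>\<bar> powr s)"
  proof (rule AE_I2)
    fix \<omega>
    show "norm (f \<omega> ^ 6) \<le> norm (1 + \<bar>f \<omega>\<bar> powr s)"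
    proof (cases "\<bar>f \<omega>\<bar> \<le> 1")
      case True
      then have "\<bar>f \<omega>\<bar> ^ 6 \<le> 1" by (intro power_le_one) auto
      moreover have "0 \<le> \<bar>f \<omega>\<bar> powr s" by simp
      ultimately show ?thesis unfolding real_norm_def power_abs by linarith
    next
      case False
      then have "\<bar>f \<omega>\<bar> ^ 6 = \<bar>f \<omega>\<bar> powr 6" by (subst powr_numeral) auto
      also have "\<dots> \<le> \<bar>f \<omega>\<bar> powr s" using False assms(3) by (intro powr_mono) auto
      finally show ?thesis unfolding real_norm_def power_abs by linarith
    qed
  qed
qed measurable

section \<open>Degenerate noise and the moment matrix; coefficients at the left end point\<close>

text \<open>\<open>lambda_min\<close> is a \<open>Min\<close>, which is a lower bound only over a
  finite set; the eigenvalues are the roots of a nonzero polynomial.\<close>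

lemma lambda_min_le:
  assumes A: "A \<in> carrier_mat m m" and e: "eigenvalue A e"
  shows "lambda_min A \<le> e"
proof -
  have "char_poly A \<noteq> 0" using degree_monic_char_poly[OF A] by auto
  then have "finite {e. eigenvalue A e}"
    unfolding eigenvalue_root_char_poly[OF A] by (rule poly_roots_finite)
  then show ?thesis unfolding lambda_min_def using e by (intro Min_le) auto
qed

text \<open>As \<open>c 0 = 1\<close>, the vector \<open>(- c 1, 1, 0, ..., 0)\<close> is orthogonal
  to \<open>c\<close>.\<close>

lemma eigenvalue_0_rank_one:
  fixes c :: "nat \<Rightarrow> real"
  assumes "c 0 = 1" "1 \<le> p"
  shows "eigenvalue (mat (p + 1) (p + 1) (\<lambda>(i, j). c i * c j)) 0"
proof -
  let ?A = "mat (p + 1) (p + 1) (\<lambda>(i, j). c i * c j)"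
  define f where "f i = (if i = 0 then - c 1 else if i = 1 then 1 else 0)" for i :: nat
  let ?v = "vec (p + 1) f"
  have "(\<Sum>j\<in>{0..<p + 1}. c i * c j * f j) = 0" for i
  proof -
    have "(\<Sum>j\<in>{0..<p + 1}. c i * c j * f j) = (\<Sum>j\<in>{0, 1}. c i * c j * f j)"
      using assms(2) by (intro sum.mono_neutral_right) (auto simp: f_def)
    also have "\<dots> = 0" using assms(1) by (simp add: f_def)
    finally show ?thesis .
  qed
  then have "?A *\<^sub>v ?v = 0 \<cdot>\<^sub>v ?v"
    by (intro eq_vecI) (simp_all add: scalar_prod_def)
  moreover have "?v \<noteq> 0\<^sub>v (p + 1)"
  proof
    assume "?v = 0\<^sub>v (p + 1)"
    then have "?v $ 1 = 0\<^sub>v (p + 1) $ 1" by simp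
    then show False using assms(2) by (simp add: f_def)
  qed
  ultimately show ?thesis unfolding eigenvalue_def eigenvector_def by (intro exI[of _ ?v]) simp
qed

context prob_space
begin

lemma Yrec_AE_const:
  assumes "\<And>t. AE \<omega> in M. (Z t \<omega>)\<^sup>2 = 1"
  shows "\<exists>c. AE \<omega> in M. Yrec a Z u t \<omega> = c"
proof (induction t rule: less_induct)
  case (less t)
  show ?case
  proof (cases t)
    case 0
    have "AE \<omega> in M. Yrec a Z u t \<omega> = a 0 u" using assms[of 0] unfolding 0 by eventually_elim simp
    then show ?thesis by blast
  next
    case (Suc k)
    have "\<forall>s\<in>{..<t}. \<exists>c. AE \<omega> in M. Yrec a Z u s \<omega> = c" using less by auto
    then obtain c where c: "\<And>s. s < t \<Longrightarrow> AE \<omega> in M. Yrec a Z u s \<omega> = c s" by (metis lessThan_iff)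
    then have "AE \<omega> in M. \<forall>s\<in>{..<t}. Yrec a Z u s \<omega> = c s" by (intro AE_finite_allI) auto
    with assms[of "int t"] have "AE \<omega> in M. Yrec a Z u t \<omega> = a 0 u + (\<Sum>j\<in>{1..t}. a j u * c (t - j))"
      by eventually_elim (auto simp: Suc intro!: sum.cong)
    then show ?thesis by blast
  qed
qed

lemma measurable_Yrec:
  assumes [measurable]: "\<And>t. Z t \<in> borel_measurable M"
  shows "Yrec a Z u t \<in> borel_measurable M"
proof (induction t rule: less_induct)
  case (less t)
  show ?case
  proof (cases t)
    case 0
    then show ?thesis by simp
  next
    case (Suc k)
    have "(\<lambda>\<omega>. \<Sum>j\<in>{1..Suc k}. a j u * Yrec a Z u (Suc k - j) \<omega>) \<in> borel_measurable M"
      using less Suc by (intro borel_measurable_sum borel_measurable_times) auto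
    then show ?thesis unfolding Suc Yrec.simps by measurable
  qed
qed

text \<open>If the squared noise is constant, then so is every \<open>Yvec\<close>, and the moment
  matrix is of rank one in dimension at least 2. Read backwards, A(r)(iv) forces nondegenerate
  squared noise.\<close>

lemma lambda_min_Ymoment_degenerate:
  assumes [measurable]: "\<And>t. Z t \<in> borel_measurable M"
  assumes "\<And>t. AE \<omega> in M. (Z t \<omega>)\<^sup>2 = 1" "1 \<le> p"
  shows "lambda_min (Ymoment M p a Z u) \<le> 0"
proof -
  define d where "d t = (SOME c. AE \<omega> in M. Yrec a Z u t \<omega> = c)" for t
  have d: "AE \<omega> in M. Yrec a Z u t \<omega> = d t" for t
    unfolding d_def by (rule someI_ex[OF Yrec_AE_const[OF assms(2)]])
  define c where "c i = (if i = 0 then 1 else d i)" for i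
  have c: "AE \<omega> in M. Yvec a Z u i \<omega> = c i" for i
    using d[of i] by eventually_elim (simp add: Yvec_def c_def)
  have "integral\<^sup>L M (\<lambda>\<omega>. Yvec a Z u i \<omega> * Yvec a Z u j \<omega>) = c i * c j" for i j
  proof -
    have "AE \<omega> in M. Yvec a Z u i \<omega> * Yvec a Z u j \<omega> = c i * c j" using c[of i] c[of j] by eventually_elim simp
    moreover have "Yvec a Z u i \<in> borel_measurable M" for i
      using measurable_Yrec[of Z a u i] by (cases "i = 0") (simp_all add: Yvec_def[abs_def])
    ultimately have "integral\<^sup>L M (\<lambda>\<omega>. Yvec a Z u i \<omega> * Yvec a Z u j \<omega>) = integral\<^sup>L M (\<lambda>\<omega>. c i * c j)"
      by (intro integral_cong_AE borel_measurable_times) auto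
    then show ?thesis by (simp add: prob_space)
  qed
  then have "Ymoment M p a Z u = mat (p + 1) (p + 1) (\<lambda>(i, j). c i * c j)"
    unfolding Ymoment_def by simp
  moreover have "eigenvalue (mat (p + 1) (p + 1) (\<lambda>(i, j). c i * c j)) 0"
    using assms(3) by (intro eigenvalue_0_rank_one) (simp_all add: c_def)
  ultimately show ?thesis using lambda_min_le[of _ "p + 1" 0] by simp
qed

end

text \<open>\<open>coef\<close> is defined through \<open>Lim\<close>, which says something only
  when the limit exists. The Hoelder bound gives uniform continuity on \<open>{0<..1}\<close>, and
  this extends to the closure.\<close>

lemma coef_tendsto_0:
  assumes "0 < \<beta>" and H: "\<And>u v. u \<in> {0<..1} \<Longrightarrow> v \<in> {0<..1} \<Longrightarrow> \<bar>a j u - a j v\<bar> \<le> K * \<bar>u - v\<bar> powr \<beta>"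
  shows "(a j \<longlongrightarrow> coef a j 0) (at_right 0)"
proof -
  have "uniformly_continuous_on {0<..1} (a j)"
    unfolding uniformly_continuous_on_def
  proof safe
    fix e :: real assume e: "0 < e"
    define d where "d = (e / (\<bar>K\<bar> + 1)) powr (1 / \<beta>)"
    have d0: "0 < d" unfolding d_def using e by simp
    have dp: "d powr \<beta> = e / (\<bar>K\<bar> + 1)" unfolding d_def using e assms(1) by (simp add: powr_powr)
    show "\<exists>d>0. \<forall>x\<in>{0<..1}. \<forall>x'\<in>{0<..1}. dist x' x < d \<longrightarrow> dist (a j x') (a j x) < e"
    proof (intro exI[of _ d] conjI ballI impI)
      fix x x' :: real assume x: "x \<in> {0<..1}" "x' \<in> {0<..1}" "dist x' x < d"
      have "\<bar>a j x' - a j x\<bar> \<le> K * \<bar>x' - x\<bar> powr \<beta>" using H x by blast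
      also have "\<dots> \<le> \<bar>K\<bar> * d powr \<beta>"
        using x assms(1) by (intro mult_mono powr_mono2) (auto simp: dist_real_def)
      also have "\<dots> < e" unfolding dp using e by (simp add: field_simps)
      finally show "dist (a j x') (a j x) < e" by (simp add: dist_real_def)
    qed (rule d0)
  qed
  moreover have "(0::real) \<in> closure {0<..1}" by simp
  ultimately obtain L where "(a j \<longlongrightarrow> L) (at 0 within {0<..1})"
    by (rule uniformly_continuous_on_extension_at_closure)
  then have L: "(a j \<longlongrightarrow> L) (at_right 0)"
    by (subst (asm) at_within_nhd[of 0 "{..<1}" "{0<..1}" "{0<..}"]) auto
  then have "Lim (at_right 0) (a j) = L" by (intro tendsto_Lim) simp_all
  with L show ?thesis by (simp add: coef_def)
qed

lemma eventually_at_right_0_Ioc: "eventually (\<lambda>u. u \<in> {0<..1::real}) (at_right 0)"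
  unfolding eventually_at_right_field by (intro exI[of _ 1]) auto

section \<open>The mean squared error\<close>

lemma anre_initial: "t \<le> p \<Longrightarrow> anre l p x t = (\<lambda>_. 0)"
  by (cases t) simp_all

text \<open>Three contributions: the initial error, contracted \<open>T - p\<close> times; the
  noise, of order \<open>l\<close>; and the bias, of order \<open>\<theta>\<close>. The recursion
  starts at time \<open>p\<close>, where the estimate is still 0 and the error is the constant
  \<open>- \<alpha>\<close>. The leading factor 2 comes from \<open>lyap_ge\<close>.\<close>

lemma (in arch_process) est_err_second_moment_le:
  fixes l c L A e \<rho> Bm k2 \<theta> m \<kappa> \<mu> l0 :: real and w :: "nat \<Rightarrow> nat \<Rightarrow> real" and Bd :: "nat \<Rightarrow> real"
  assumes params: "0 < \<kappa>" "\<kappa> \<le> 1" "0 < \<mu>" "\<mu> \<le> 1" "0 < c" "c \<le> 1" "0 \<le> L" "l0 \<le> 1" "l0 * p \<le> 1/2"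
    and drift: "\<forall>l B w w' a v y \<alpha>. 0 < l \<and> l \<le> l0 \<and> 0 \<le> B \<and> B \<le> Bm \<and> step_ok p A e \<rho> B y a w w' \<alpha> \<longrightarrow>
      (\<integral>\<^sup>+z. ennreal (lyap p \<kappa> \<mu> l w' (nlms p l \<alpha> v y ((\<Sum>i\<le>p. a i * y i) * z\<^sup>2))
              (shift_in p ((\<Sum>i\<le>p. a i * y i) * z\<^sup>2) y)) \<partial>\<nu>)
        \<le> ennreal ((1 - c * l) * lyap p \<kappa> \<mu> l w v y + 2 * l * B\<^sup>2 + l\<^sup>2 * L * norm1 p y)"
    and l: "0 < l" "l \<le> l0"
    and ok: "\<And>t y. p \<le> t \<Longrightarrow> t < T \<Longrightarrow> y 0 = 1 \<Longrightarrow> (\<And>i. i \<le> p \<Longrightarrow> 0 \<le> y i) \<Longrightarrow>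
      step_ok p A e \<rho> (Bd t) y (\<lambda>i. b i (int (Suc t))) (w t) (w (Suc t)) \<alpha>"
    and w: "\<And>t i. p \<le> t \<Longrightarrow> t \<le> T \<Longrightarrow> i \<in> {1..p} \<Longrightarrow> 0 \<le> w t i \<and> w t i \<le> 1"
    and Bd: "\<And>t. p \<le> t \<Longrightarrow> t < T \<Longrightarrow> 0 \<le> Bd t \<and> Bd t \<le> Bm \<and> 2 * (Bd t)\<^sup>2 \<le> k2 * \<theta> * (1 + (real (T - t) * l)\<^sup>2)"
    and k2: "0 \<le> k2" and \<theta>: "0 \<le> \<theta>"
    and mom: "\<And>s. s \<le> n \<Longrightarrow> (\<integral>\<^sup>+\<omega>. ennreal ((X s \<omega>)\<^sup>2) \<partial>M) \<le> ennreal m" "0 \<le> m"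
    and T: "p \<le> T" "int T \<le> n"
  shows "(\<integral>\<^sup>+\<omega>. ennreal (sq_norm p (est_err l \<alpha> T \<omega>)) \<partial>M)
    \<le> ennreal (2 * ((1 - c * l) ^ (T - p) * (sq_norm p \<alpha> * (1 + p * m)) + l * (L * (1 + p * m) / c) + \<theta> * (2 * k2 / c * (6 / c)\<^sup>2)))"
proof -
  define u where "u t = (\<integral>\<^sup>+\<omega>. ennreal (lyap p \<kappa> \<mu> l (w t) (est_err l \<alpha> t \<omega>) (regr t \<omega>)) \<partial>M)" for t
  have l1: "l \<le> 1" using l params by simp
  have lp: "l * p \<le> 1/2" using params(9) mult_right_mono[OF l(2), of p] by simp
  have cl: "0 \<le> 1 - c * l" using params l l1 mult_le_one[of c l] by simp
  have lyap_half: "sq_norm p v / 2 \<le> lyap p \<kappa> \<mu> l (w t) v y"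
    if "p \<le> t" "t \<le> T" "y 0 = 1" "\<And>i. i \<le> p \<Longrightarrow> 0 \<le> y i" for v y t
    using that p params l lp w[OF that(1,2)] by (intro lyap_ge) auto
  have lyap_pos: "0 \<le> lyap p \<kappa> \<mu> l (w t) v y"
    if "p \<le> t" "t \<le> T" "y 0 = 1" "\<And>i. i \<le> p \<Longrightarrow> 0 \<le> y i" for v y t
    by (rule order_trans[OF _ lyap_half]) (use that sq_norm_nonneg in auto)
  have "u T \<le> ennreal ((1 - c * l) ^ (T - p) * (sq_norm p \<alpha> * (1 + p * m)) + l * (L * (1 + p * m) / c) + \<theta> * (2 * k2 / c * (6 / c)\<^sup>2))"
  proof (rule contraction_recursion)
    have "u p \<le> (\<integral>\<^sup>+\<omega>. ennreal (sq_norm p \<alpha>) * ennreal (norm1 p (regr p \<omega>)) \<partial>M)"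
      unfolding u_def
    proof (rule nn_integral_mono)
      fix \<omega>
      have "est_err l \<alpha> p \<omega> = (\<lambda>i. - \<alpha> i)"
        by (intro ext) (simp add: est_err_def anre_initial)
      then have "sq_norm p (est_err l \<alpha> p \<omega>) = sq_norm p \<alpha>" by (simp add: sq_norm_def)
      moreover have "lyap p \<kappa> \<mu> l (w p) (est_err l \<alpha> p \<omega>) (regr p \<omega>) \<le> sq_norm p (est_err l \<alpha> p \<omega>) * norm1 p (regr p \<omega>)"
        using params l l1 T w[of p] by (intro lyap_le regr_0 regr_nonneg) auto
      ultimately show "ennreal (lyap p \<kappa> \<mu> l (w p) (est_err l \<alpha> p \<omega>) (regr p \<omega>)) \<le> ennreal (sq_norm p \<alpha>) * ennreal (norm1 p (regr p \<omega>))"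
        by (simp add: ennreal_mult'[symmetric] sq_norm_nonneg ennreal_leI)
    qed
    also have "\<dots> = ennreal (sq_norm p \<alpha>) * (\<integral>\<^sup>+\<omega>. ennreal (norm1 p (regr p \<omega>)) \<partial>M)"
    proof (rule nn_integral_cmult)
      have [measurable]: "(\<lambda>\<omega>. regr p \<omega> i) \<in> borel_measurable M" for i
        using T by (intro measurable_past_M[OF measurable_regr]) simp
      show "(\<lambda>\<omega>. ennreal (norm1 p (regr p \<omega>))) \<in> borel_measurable M" unfolding norm1_def by measurable
    qed
    also have "\<dots> \<le> ennreal (sq_norm p \<alpha>) * ennreal (1 + p * m)"
      using T by (intro mult_left_mono nn_integral_norm1_regr mom) auto
    also have "\<dots> = ennreal (sq_norm p \<alpha> * (1 + p * m))"
      using sq_norm_nonneg by (simp add: ennreal_mult')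
    finally show "u p \<le> ennreal (sq_norm p \<alpha> * (1 + p * m))" .
    show "0 \<le> sq_norm p \<alpha> * (1 + p * m)" using sq_norm_nonneg mom(2) by simp
    show "0 \<le> L * (1 + p * m)" using params mom(2) by simp
    fix t assume t: "p \<le> t" "t < T"
    have "u (Suc t) \<le> ennreal (1 - c * l) * u t + ennreal (2 * l * (Bd t)\<^sup>2 + l\<^sup>2 * L * (1 + p * m))"
      unfolding u_def
    proof (rule nn_integral_lyap_step[OF t(1)])
      show "int (Suc t) \<le> n" using t T by simp
      show "0 \<le> 2 * l * (Bd t)\<^sup>2" "0 \<le> l\<^sup>2 * L" using l params by auto
      show "0 \<le> lyap p \<kappa> \<mu> l (w t) v y" if "y 0 = 1" "\<And>i. i \<le> p \<Longrightarrow> 0 \<le> y i" for v y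
        using t that by (intro lyap_pos) auto
      fix v y assume y: "y 0 = (1::real)" "\<And>i. i \<le> p \<Longrightarrow> 0 \<le> y i"
      have so: "step_ok p A e \<rho> (Bd t) y (\<lambda>i. b i (int (Suc t))) (w t) (w (Suc t)) \<alpha>"
        by (rule ok) (use t y in auto)
      show "(\<integral>\<^sup>+z. ennreal (lyap p \<kappa> \<mu> l (w (Suc t)) (nlms p l \<alpha> v y ((\<Sum>i\<le>p. b i (int (Suc t)) * y i) * z\<^sup>2))
              (shift_in p ((\<Sum>i\<le>p. b i (int (Suc t)) * y i) * z\<^sup>2) y)) \<partial>\<nu>)
        \<le> ennreal ((1 - c * l) * lyap p \<kappa> \<mu> l (w t) v y + 2 * l * (Bd t)\<^sup>2 + l\<^sup>2 * L * norm1 p y)"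
        using drift[rule_format, of l "Bd t" y "\<lambda>i. b i (int (Suc t))" "w t" "w (Suc t)" \<alpha> v] l Bd[OF t] so by blast
    qed (use mom cl in auto)
    also have "2 * l * (Bd t)\<^sup>2 + l\<^sup>2 * L * (1 + p * m) \<le> l * (k2 * \<theta> * (1 + (real (T - t) * l)\<^sup>2)) + l\<^sup>2 * (L * (1 + p * m))"
      using mult_left_mono[of "2 * (Bd t)\<^sup>2" "k2 * \<theta> * (1 + (real (T - t) * l)\<^sup>2)" l] Bd[OF t] l by (simp add: mult_ac)
    finally show "u (Suc t) \<le> ennreal (1 - c * l) * u t + ennreal (l * (k2 * \<theta> * (1 + (real (T - t) * l)\<^sup>2)) + l\<^sup>2 * (L * (1 + p * m)))"
      by (simp add: add_left_mono ennreal_leI)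
  qed (use params l l1 k2 \<theta> T in auto)
  then have uT: "2 * u T \<le> 2 * ennreal ((1 - c * l) ^ (T - p) * (sq_norm p \<alpha> * (1 + p * m)) + l * (L * (1 + p * m) / c) + \<theta> * (2 * k2 / c * (6 / c)\<^sup>2))"
    by (rule mult_left_mono) simp
  have "(\<integral>\<^sup>+\<omega>. ennreal (sq_norm p (est_err l \<alpha> T \<omega>)) \<partial>M) \<le> (\<integral>\<^sup>+\<omega>. 2 * ennreal (lyap p \<kappa> \<mu> l (w T) (est_err l \<alpha> T \<omega>) (regr T \<omega>)) \<partial>M)"
  proof (rule nn_integral_mono)
    fix \<omega>
    have "sq_norm p (est_err l \<alpha> T \<omega>) \<le> 2 * lyap p \<kappa> \<mu> l (w T) (est_err l \<alpha> T \<omega>) (regr T \<omega>)"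
      using lyap_half[of T "regr T \<omega>" "est_err l \<alpha> T \<omega>"] T regr_0 regr_nonneg by simp
    then have "ennreal (sq_norm p (est_err l \<alpha> T \<omega>)) \<le> ennreal (2 * lyap p \<kappa> \<mu> l (w T) (est_err l \<alpha> T \<omega>) (regr T \<omega>))"
      by (rule ennreal_leI)
    then show "ennreal (sq_norm p (est_err l \<alpha> T \<omega>)) \<le> 2 * ennreal (lyap p \<kappa> \<mu> l (w T) (est_err l \<alpha> T \<omega>) (regr T \<omega>))"
      by (simp add: ennreal_mult')
  qed
  also have "\<dots> = 2 * u T"
  proof -
    note [measurable] = measurable_past_M[OF measurable_regr[OF T(2)]] measurable_past_M[OF measurable_est_err[OF T(2)]]
    show ?thesis unfolding u_def lyap_def sq_norm_def wsum_def tail_form_def norm1_def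
      by (rule nn_integral_cmult) measurable
  qed
  also note uT
  finally show ?thesis by (subst ennreal_mult') simp_all
qed

text \<open>It brings the Hoelder bias into the quadratic form that
  \<open>contraction_recursion\<close> expects.\<close>

lemma powr_le_one_plus_square:
  fixes x b :: real
  assumes "0 \<le> x" "0 < b" "b \<le> 1"
  shows "x powr (2 * b) \<le> 1 + x\<^sup>2"
proof (cases "x \<le> 1")
  case True
  then have "x powr (2 * b) \<le> 1" using assms by (intro powr_le1) auto
  then show ?thesis by (simp add: add_increasing2)
next
  case False
  then have "x powr (2 * b) \<le> x powr 2" using assms by (intro powr_mono) auto
  then show ?thesis using assms(1) by simp
qed

theorem theorem2p1:
  fixes M :: "'s measure"
    and p :: nat
    and Z :: "int \<Rightarrow> 's \<Rightarrow> real"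
    and a :: "nat \<Rightarrow> real \<Rightarrow> real"
    and X :: "nat \<Rightarrow> int \<Rightarrow> 's \<Rightarrow> real"
    and r \<eta> \<rho>1 \<rho>2 \<beta> K C \<epsilon> u0 :: real
    and lam :: "nat \<Rightarrow> real"
    and t0 :: "nat \<Rightarrow> nat"
  assumes M: "prob_space M"
    and p: "p \<ge> 1"
    (* Z_t i.i.d., mean 0, variance 1 *)
    and Z_rv: "\<And>t. Z t \<in> borel_measurable M"
    and Z_indep: "prob_space.indep_vars M (\<lambda>_. borel) Z UNIV"
    and Z_ident: "\<And>t. distr M borel (Z t) = distr M borel (Z 0)"
    and Z_int2: "integrable M (\<lambda>\<omega>. (Z 0 \<omega>)\<^sup>2)"
    and Z_mean: "integral\<^sup>L M (Z 0) = 0"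
    and Z_var: "integral\<^sup>L M (\<lambda>\<omega>. (Z 0 \<omega>)\<^sup>2) = 1"
    (* coefficient functions a_0..a_p : (0,1] \<rightarrow> [0,\<infinity>) *)
    and a_nonneg: "\<And>j u. j \<le> p \<Longrightarrow> u \<in> {0<..1} \<Longrightarrow> a j u \<ge> 0"
    (* the tvARCH process X_{t,N}, t \<le> N (causal, square-integrable solution) *)
    and X_rec: "\<And>N t \<omega>. N \<ge> 1 \<Longrightarrow> t \<le> int N \<Longrightarrow> \<omega> \<in> space M \<Longrightarrow>
        X N t \<omega> = Z t \<omega> * sqrt (coef a 0 (real_of_int t / real N)
           + (\<Sum>j\<in>{1..p}. coef a j (real_of_int t / real N) * (X N (t - int j) \<omega>)\<^sup>2))"
    and X_rv: "\<And>N t. X N t \<in> borel_measurable M"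
    and X_causal: "\<And>N t. N \<ge> 1 \<Longrightarrow> t \<le> int N \<Longrightarrow>
        X N t \<in> borel_measurable
          (sigma (space M) (\<Union>s\<in>{..t}. {Z s -` A \<inter> space M | A. A \<in> sets borel}))"
    and X_L2: "\<And>N. N \<ge> 1 \<Longrightarrow> \<exists>B. \<forall>t\<le>int N.
        integrable M (\<lambda>\<omega>. (X N t \<omega>)\<^sup>2) \<and> integral\<^sup>L M (\<lambda>\<omega>. (X N t \<omega>)\<^sup>2) \<le> B"
    (* Assumption A(r) with r > 4 *)
    and r: "r > 4"
    and Z_int2r: "integrable M (\<lambda>\<omega>. \<bar>Z 0 \<omega>\<bar> powr (2 * r))"
    and A1: "\<eta> > 0"
        "(integral\<^sup>L M (\<lambda>\<omega>. \<bar>Z 0 \<omega>\<bar> powr (2 * r))) powr (1 / r)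
           * (SUP u\<in>{0<..1}. \<Sum>j\<in>{1..p}. a j u) < 1 - \<eta>"
    and A2: "0 < \<rho>1" "\<rho>1 \<le> \<rho>2" "\<And>u. u \<in> {0<..1} \<Longrightarrow> \<rho>1 \<le> a 0 u \<and> a 0 u \<le> \<rho>2"
    and A3: "0 < \<beta>" "\<beta> \<le> 1"
        "\<And>j u v. j \<le> p \<Longrightarrow> u \<in> {0<..1} \<Longrightarrow> v \<in> {0<..1} \<Longrightarrow>
           \<bar>a j u - a j v\<bar> \<le> K * \<bar>u - v\<bar> powr \<beta>"
    and A4: "C > 0" "\<And>u. u \<in> {0<..1} \<Longrightarrow> lambda_min (Ymoment M p a Z u) \<ge> C"
    (* step size *)
    and lam_pos: "\<And>N. lam N > 0"
    and lam_lim: "lam \<longlonglongrightarrow> 0"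
    and eps: "\<epsilon> > 0"
    and lam_rate: "(\<lambda>N. (ln (real N)) powr (1 + \<epsilon>)) \<in> o(\<lambda>N. real N * lam N)"
    (* the point of estimation *)
    and u0: "u0 \<in> {0<..1}"
    and t0: "\<And>N. N \<ge> 1 \<Longrightarrow> \<bar>u0 - real (t0 N) / real N\<bar> < 1 / real N"
  shows "(\<forall>\<^sub>F N in sequentially. integrable M
            (\<lambda>\<omega>. \<Sum>i\<le>p. (anre (lam N) p (\<lambda>t. X N t \<omega>) (t0 N) i - a i u0)\<^sup>2))
       \<and> (\<lambda>N. integral\<^sup>L M
            (\<lambda>\<omega>. \<Sum>i\<le>p. (anre (lam N) p (\<lambda>t. X N t \<omega>) (t0 N) i - a i u0)\<^sup>2))
         \<in> O(\<lambda>N. lam N + 1 / (real N * lam N) powr (2 * \<beta>))"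
proof -
  interpret prob_space M by (rule M)
  note [measurable] = Z_rv
  define \<nu> where "\<nu> = distr M borel (Z 0)"
  define K' where "K' = \<bar>K\<bar>"
  have K': "0 \<le> K'" by (simp add: K'_def)
  have holder: "\<bar>a j u - a j v\<bar> \<le> K' * \<bar>u - v\<bar> powr \<beta>" if "j \<le> p" "u \<in> {0<..1}" "v \<in> {0<..1}" for j u v
    by (rule order_trans[OF A3(3)[OF that]]) (auto simp: K'_def intro: mult_right_mono)
  \<comment> \<open>Nondegeneracy of the squared noise follows from A(r)(iv), applied at the single
    point 1.\<close>
  interpret noise: square_noise \<nu>
  proof -
    interpret N: prob_space \<nu> unfolding \<nu>_def by (rule prob_space_distr) simp
    show "square_noise \<nu>"
    proof
      show "sets \<nu> = sets borel" by (simp add: \<nu>_def)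
      show "integrable \<nu> (\<lambda>z. z ^ 6)"
        unfolding \<nu>_def using integrable_sixth_power[OF Z_rv Z_int2r] r by (simp add: integrable_distr_eq)
      show "(\<integral>z. z\<^sup>2 \<partial>\<nu>) = 1"
        unfolding \<nu>_def using Z_var by (simp add: integral_distr)
      show "\<not> (AE z in \<nu>. z\<^sup>2 = 1)"
      proof
        assume ae: "AE z in \<nu>. z\<^sup>2 = 1"
        have "AE \<omega> in M. (Z t \<omega>)\<^sup>2 = 1" for t
          using ae unfolding \<nu>_def Z_ident[of t, symmetric] by (simp add: AE_distr_iff)
        then have "lambda_min (Ymoment M p a Z 1) \<le> 0"
          using p Z_rv by (intro lambda_min_Ymoment_degenerate) auto
        then show False using A4(1) A4(2)[of 1] by simp
      qed
    qed
  qed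
  have noise_sq: "(\<integral>\<^sup>+z. ennreal (z\<^sup>2) \<partial>\<nu>) = 1"
    using noise.integrable_square noise.square_mean by (subst nn_integral_eq_integral) auto
  have a_sum: "(\<Sum>j\<in>{1..p}. a j u) \<le> 1 - \<eta>" if u: "u \<in> {0<..1}" for u
  proof -
    \<comment> \<open>A real supremum is an upper bound only for a bounded set; comparison with the
      point 1 bounds it.\<close>
    have "(\<Sum>j\<in>{1..p}. a j v) \<le> (\<Sum>j\<in>{1..p}. a j 1 + K')" if v: "v \<in> {0<..1}" for v
    proof (rule sum_mono)
      fix j assume j: "j \<in> {1..p}"
      have "\<bar>v - 1\<bar> powr \<beta> \<le> 1" using v A3 by (intro powr_le1) auto
      then have "K' * \<bar>v - 1\<bar> powr \<beta> \<le> K' * 1" using K' by (intro mult_left_mono) auto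
      then show "a j v \<le> a j 1 + K'" using holder[of j v 1] v j by auto
    qed
    then have "bdd_above ((\<lambda>u. \<Sum>j\<in>{1..p}. a j u) ` {0<..1})" by (intro bdd_aboveI2) blast
    then have le: "(\<Sum>j\<in>{1..p}. a j u) \<le> (SUP u\<in>{0<..1}. \<Sum>j\<in>{1..p}. a j u)"
      using u by (intro cSUP_upper)
    have "0 \<le> (\<Sum>j\<in>{1..p}. a j u)" using a_nonneg u by (intro sum_nonneg) auto
    with le have S0: "0 \<le> (SUP u\<in>{0<..1}. \<Sum>j\<in>{1..p}. a j u)" by linarith
    have "1 \<le> (\<integral>\<omega>. \<bar>Z 0 \<omega>\<bar> powr (2 * r) \<partial>M)"
      using Z_int2 Z_var Z_int2r r by (intro moment_powr_ge_1) auto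
    then have "1 \<le> (\<integral>\<omega>. \<bar>Z 0 \<omega>\<bar> powr (2 * r) \<partial>M) powr (1 / r)"
      using r by (intro ge_one_powr_ge_zero) auto
    then have "1 * (SUP u\<in>{0<..1}. \<Sum>j\<in>{1..p}. a j u) \<le>
        (\<integral>\<omega>. \<bar>Z 0 \<omega>\<bar> powr (2 * r) \<partial>M) powr (1 / r) * (SUP u\<in>{0<..1}. \<Sum>j\<in>{1..p}. a j u)"
      using S0 by (intro mult_right_mono)
    then show ?thesis using A1(2) le by linarith
  qed
  have eta1: "\<eta> \<le> 1"
  proof -
    have "0 \<le> (\<Sum>j\<in>{1..p}. a j 1)" using a_nonneg by (intro sum_nonneg) auto
    then show ?thesis using a_sum[of 1] by simp
  qed
  \<comment> \<open>At nonpositive times the coefficients are these limits, to which the bounds on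
    \<open>{0<..1}\<close> pass.\<close>
  have coef_lim: "(a j \<longlongrightarrow> coef a j 0) (at_right 0)" if "j \<le> p" for j
    using A3(1) A3(3)[OF that] by (rule coef_tendsto_0)
  have coef_pos: "coef a j u = (if u \<le> 0 then coef a j 0 else a j u)" for j u
    by (simp add: coef_def)
  have coef_nonneg: "0 \<le> coef a j u" if "j \<le> p" "u \<le> 1" for j u
  proof -
    have "0 \<le> coef a j 0"
      using coef_lim[OF that(1)] by (rule tendsto_lowerbound)
        (auto intro!: eventually_mono[OF eventually_at_right_0_Ioc] a_nonneg that)
    then show ?thesis using a_nonneg[OF that(1), of u] that by (subst coef_pos) auto
  qed
  have coef_0_le: "coef a 0 u \<le> \<rho>2" if "u \<le> 1" for u
  proof -
    have "coef a 0 0 \<le> \<rho>2"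
      using coef_lim[of 0] by (rule tendsto_upperbound)
        (auto intro!: eventually_mono[OF eventually_at_right_0_Ioc] simp: A2(3))
    then show ?thesis using A2(3)[of u] that by (subst coef_pos) auto
  qed
  have coef_sum: "(\<Sum>j\<in>{1..p}. coef a j u) \<le> 1 - \<eta>" if "u \<le> 1" for u
  proof (cases "u \<le> 0")
    case True
    have "((\<lambda>u. \<Sum>j\<in>{1..p}. a j u) \<longlongrightarrow> (\<Sum>j\<in>{1..p}. coef a j 0)) (at_right 0)"
      by (intro tendsto_sum coef_lim) auto
    then have "(\<Sum>j\<in>{1..p}. coef a j 0) \<le> 1 - \<eta>"
      by (rule tendsto_upperbound) (rule eventually_mono[OF eventually_at_right_0_Ioc], erule a_sum, simp)
    with True show ?thesis by (simp add: coef_def)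
  next
    case False
    then show ?thesis using a_sum[of u] that by (simp add: coef_def)
  qed
  have proc: "arch_process M Z (X N) \<nu> p (int N) (\<lambda>j t. coef a j (real_of_int t / real N))" if N: "N \<ge> 1" for N
  proof
    fix t :: int assume t: "t \<le> int N"
    then have tN: "real_of_int t / real N \<le> 1" using N by (simp add: field_simps)
    show "X N t \<in> borel_measurable (past M Z t)"
      using X_causal[OF N t] by (simp add: past_def)
    fix \<omega> assume \<omega>: "\<omega> \<in> space M"
    let ?s = "coef a 0 (real_of_int t / real N) + (\<Sum>j\<in>{1..p}. coef a j (real_of_int t / real N) * (X N (t - int j) \<omega>)\<^sup>2)"
    have "0 \<le> ?s" using coef_nonneg[OF _ tN] by (intro add_nonneg_nonneg sum_nonneg mult_nonneg_nonneg) auto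
    then show "(X N t \<omega>)\<^sup>2 = ?s * (Z t \<omega>)\<^sup>2"
      by (subst X_rec[OF N t \<omega>]) (simp add: power_mult_distrib mult.commute)
  next
    fix j t assume "j \<le> p" "t \<le> int N"
    then show "0 \<le> coef a j (real_of_int t / real N)"
      using N by (intro coef_nonneg) (auto simp: field_simps)
  qed (use p Z_indep Z_ident X_rv noise_sq in \<open>auto simp: \<nu>_def\<close>)
  have moment: "(\<integral>\<^sup>+\<omega>. ennreal ((X N t \<omega>)\<^sup>2) \<partial>M) \<le> ennreal (\<rho>2 / \<eta>)" if N: "N \<ge> 1" and t: "t \<le> int N" for N t
  proof -
    interpret arch_process M Z "X N" \<nu> p "int N" "\<lambda>j t. coef a j (real_of_int t / real N)" using N by (rule proc)
    obtain B where B: "\<And>t. t \<le> int N \<Longrightarrow> integrable M (\<lambda>\<omega>. (X N t \<omega>)\<^sup>2) \<and> integral\<^sup>L M (\<lambda>\<omega>. (X N t \<omega>)\<^sup>2) \<le> B"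
      using X_L2[OF N] by blast
    show ?thesis
    proof (rule second_moment_bound[OF _ _ A1(1) _ t])
      fix s assume s: "s \<le> int N"
      then have "real_of_int s / real N \<le> 1" using N by (simp add: field_simps)
      then show "coef a 0 (real_of_int s / real N) \<le> \<rho>2" "(\<Sum>j\<in>{1..p}. coef a j (real_of_int s / real N)) \<le> 1 - \<eta>"
        using coef_0_le coef_sum by auto
      show "(\<integral>\<^sup>+\<omega>. ennreal ((X N s \<omega>)\<^sup>2) \<partial>M) \<le> ennreal B"
        using B[OF s] by (subst nn_integral_eq_integral) (auto intro: ennreal_leI)
    qed
  qed
  define A where "A = max \<rho>2 1"
  \<comment> \<open>The slack \<open>\<eta>\<close> is shared among \<open>p + 1\<close> indices, so
    that \<open>\<delta> * p = \<eta> - \<delta>\<close>. Each weight loses \<open>\<delta>\<close>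
    against its successor: one half pays for the change of the coefficients between consecutive
    times, the other half is the drift \<open>e\<close>.\<close>
  define \<delta> where "\<delta> = \<eta> / (p + 1)"
  define e where "e = \<delta> / 2"
  define \<rho> where "\<rho> = min \<rho>1 1"
  have \<delta>: "0 < \<delta>" "\<delta> * p \<le> \<eta> - \<delta>" using A1(1) by (auto simp: \<delta>_def field_simps)
  have "0 \<le> \<delta> * p" using \<delta>(1) by simp
  then have "\<delta> \<le> \<eta>" using \<delta>(2) by linarith
  then have e: "0 < e" "e \<le> 1" using \<delta> eta1 by (auto simp: e_def)
  have A1': "1 \<le> A" "0 < \<rho>" "\<rho> \<le> 1" using A2 by (auto simp: A_def \<rho>_def)
  obtain \<kappa> \<mu> c L and l0 :: real where params: "0 < \<kappa>" "\<kappa> \<le> 1" "0 < \<mu>" "\<mu> \<le> 1" "0 < c" "c \<le> 1" "0 \<le> L" and l0: "0 < l0"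
    and params': "l0 \<le> 1" "l0 * p \<le> 1/2"
    and drift: "\<forall>l B w w' a v y \<alpha>. 0 < l \<and> l \<le> l0 \<and> 0 \<le> B \<and> B \<le> K' \<and> step_ok p A e \<rho> B y a w w' \<alpha> \<longrightarrow>
      (\<integral>\<^sup>+z. ennreal (lyap p \<kappa> \<mu> l w' (nlms p l \<alpha> v y ((\<Sum>i\<le>p. a i * y i) * z\<^sup>2))
              (shift_in p ((\<Sum>i\<le>p. a i * y i) * z\<^sup>2) y)) \<partial>\<nu>)
        \<le> ennreal ((1 - c * l) * lyap p \<kappa> \<mu> l w v y + 2 * l * B\<^sup>2 + l\<^sup>2 * L * norm1 p y)"
    using noise.lyap_drift[OF p A1'(1) e A1'(2,3), of K'] by (elim exE conjE) (rule that)
  \<comment> \<open>The coefficient vector varies with time, so no fixed weights give \<open>V\<close> a negative drift; tail sums of the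
    current coefficients do, because consecutive coefficient vectors are close.\<close>
  define wt where "wt u j = (if j = 1 then 1 else (\<Sum>i\<in>{j..p}. a i u) + \<delta> * (real p + 1 - real j))" for u and j :: nat
  have wt_range: "0 \<le> wt u j \<and> wt u j \<le> 1" if u: "u \<in> {0<..1}" and j: "j \<in> {1..p}" for u j
  proof -
    have s0: "0 \<le> (\<Sum>i\<in>{j..p}. a i u)" using a_nonneg u by (intro sum_nonneg) auto
    have "(\<Sum>i\<in>{j..p}. a i u) \<le> (\<Sum>i\<in>{1..p}. a i u)" using a_nonneg u j by (intro sum_mono2) auto
    moreover have "\<delta> * (real p + 1 - real j) \<le> \<delta> * p" "0 \<le> \<delta> * (real p + 1 - real j)" using \<delta> j by (auto intro!: mult_left_mono)
    ultimately have "(\<Sum>i\<in>{j..p}. a i u) + \<delta> * (real p + 1 - real j) \<le> 1" "0 \<le> (\<Sum>i\<in>{j..p}. a i u) + \<delta> * (real p + 1 - real j)"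
      using a_sum[OF u] \<delta> s0 by linarith+
    then show ?thesis by (simp add: wt_def)
  qed
  have wt_step: "a i u + (if i < p then wt u (Suc i) else 0) \<le> wt v i - e"
    if u: "u \<in> {0<..1}" "v \<in> {0<..1}" and i: "i \<in> {1..p}" and close: "p * (K' * \<bar>u - v\<bar> powr \<beta>) \<le> e" for u v i
  proof -
    \<comment> \<open>One formula for all \<open>i\<close>: at \<open>i = p\<close> the absent
      weight corresponds to an empty sum and \<open>\<delta> * 0\<close>.\<close>
    have tail: "a i u + (if i < p then wt u (Suc i) else 0) = (\<Sum>k\<in>{i..p}. a k u) + \<delta> * (real p - real i)"
      using i by (auto simp: wt_def sum.atLeast_Suc_atMost)
    show ?thesis
    proof (cases "i = 1")
      case True
      have "\<delta> * (real p - 1) = \<delta> * p - \<delta>" by (simp add: algebra_simps)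
      then have "(\<Sum>k\<in>{1..p}. a k u) + \<delta> * (real p - 1) \<le> 1 - 2 * \<delta>" using a_sum[OF u(1)] \<delta>(2) by linarith
      then show ?thesis unfolding tail using True \<delta>(1) by (simp add: wt_def e_def)
    next
      case False
      have "(\<Sum>k\<in>{i..p}. a k u) - (\<Sum>k\<in>{i..p}. a k v) \<le> (\<Sum>k\<in>{i..p}. K' * \<bar>u - v\<bar> powr \<beta>)"
        unfolding sum_subtractf[symmetric] using holder u by (intro sum_mono) (auto intro: order_trans[OF abs_ge_self])
      also have "\<dots> \<le> (\<Sum>k\<in>{1..p}. K' * \<bar>u - v\<bar> powr \<beta>)" using K' i by (intro sum_mono2) auto
      also have "\<dots> \<le> e" using close by simp
      finally show ?thesis unfolding tail using False by (simp add: wt_def e_def algebra_simps)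
    qed
  qed
  define \<alpha> where "\<alpha> i = a i u0" for i
  define m where "m = \<rho>2 / \<eta>"
  have m0: "0 \<le> m" using A1(1) A2 by (simp add: m_def)
  define \<theta> where "\<theta> N = 1 / (real N * lam N) powr (2 * \<beta>)" for N
  \<comment> \<open>\<open>C2\<close>, \<open>C3\<close> and \<open>C4\<close> belong to the initial
    error, the noise and the bias. The 8 is \<open>2 / (1/2)^2\<close>, since about half of the
    \<open>N * u0\<close> steps are counted.\<close>
  define C2 where "C2 = 8 / (u0 * c)\<^sup>2 * (sq_norm p \<alpha> * (1 + p * m))"
  define C3 where "C3 = L * (1 + p * m) / c"
  define C4 where "C4 = 2 * (2 * K'\<^sup>2) / c * (6 / c)\<^sup>2"
  define C1 where "C1 = 2 * (C2 + C3 + C4)"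
  have C234: "0 \<le> C2" "0 \<le> C3" "0 \<le> C4"
    unfolding C2_def C3_def C4_def using sq_norm_nonneg[of p \<alpha>] m0 params by simp_all
  \<comment> \<open>\<open>close\<close> makes the weights at consecutive times compatible in the
    sense of \<open>wt_step\<close>; \<open>big\<close> ensures at least \<open>N * u0 / 2\<close>
    updates before \<open>t0 N\<close>.\<close>
  have main: "(\<integral>\<^sup>+\<omega>. ennreal (\<Sum>i\<le>p. (anre (lam N) p (\<lambda>t. X N t \<omega>) (t0 N) i - a i u0)\<^sup>2) \<partial>M) \<le> ennreal (C1 * (lam N + \<theta> N))"
    if N: "N \<ge> 1" and lN: "lam N \<le> l0" and NlN: "1 \<le> real N * lam N" and close: "p * (K' * (1 / real N) powr \<beta>) \<le> e"
      and big: "2 * (real p + 1) \<le> real N * u0" for N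
  proof -
    interpret arch_process M Z "X N" \<nu> p "int N" "\<lambda>j t. coef a j (real_of_int t / real N)" using N by (rule proc)
    define T where "T = t0 N"
    define l where "l = lam N"
    have l: "0 < l" "l \<le> l0" using lam_pos lN by (auto simp: l_def)
    have Tdist: "\<bar>u0 - real T / real N\<bar> < 1 / real N" using t0[OF N] by (simp add: T_def)
    then have TN: "real T < real N * u0 + 1" "real N * u0 < real T + 1" using N by (auto simp: abs_less_iff field_simps)
    have "real N * u0 \<le> real N" using u0 by (simp add: mult_left_le)
    then have T: "T \<le> N" using TN by linarith
    have big': "2 * (real p + 1) < real T + 1" using big TN(2) by (rule order_le_less_trans)
    then have pT: "p \<le> T" by simp
    have "real (T - p) = real T - real p" using pT by (simp add: of_nat_diff)
    then have half: "real N * u0 / 2 \<le> real (T - p)" using TN(2) big' by argo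
    have \<theta>0: "0 \<le> \<theta> N" by (simp add: \<theta>_def)
    define Bd where "Bd t = K' * \<bar>real (Suc t) / real N - u0\<bar> powr \<beta>" for t :: nat
    define w where "w t = wt (real t / real N)" for t :: nat
    have tu: "real t / real N \<in> {0<..1}" if "p \<le> t" "t \<le> T" for t
      using that p T N by auto
    have est: "(\<integral>\<^sup>+\<omega>. ennreal (sq_norm p (est_err l \<alpha> T \<omega>)) \<partial>M)
      \<le> ennreal (2 * ((1 - c * l) ^ (T - p) * (sq_norm p \<alpha> * (1 + p * m)) + l * (L * (1 + p * m) / c) + \<theta> N * (2 * (2 * K'\<^sup>2) / c * (6 / c)\<^sup>2)))"
    proof (rule est_err_second_moment_le[OF params params' drift l, where w = w and Bd = Bd])
      show "0 \<le> w t i \<and> w t i \<le> 1" if "p \<le> t" "t \<le> T" "i \<in> {1..p}" for t i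
        unfolding w_def using tu that by (intro wt_range) auto
      fix t assume t: "p \<le> t" "t < T"
      have tu1: "real (Suc t) / real N \<in> {0<..1}" using tu[of "Suc t"] t by simp
      \<comment> \<open>The update at \<open>t\<close> uses the coefficients of time
        \<open>Suc t\<close>, which is only \<open>T - t - 1\<close> steps from \<open>T\<close>.
        The spare \<open>1 / N\<close> absorbs the distance from \<open>T / N\<close> to
        \<open>u0\<close>.\<close>
      have "\<bar>real (Suc t) / real N - u0\<bar> \<le> real (T - t) / real N"
      proof -
        have "real (T - t) / real N = real T / real N - real (Suc t) / real N + 1 / real N"
          using t N by (simp add: of_nat_diff field_simps)
        moreover have "real (Suc t) / real N \<le> real T / real N" using t by (intro divide_right_mono) auto
        ultimately show ?thesis using Tdist by linarith
      qed
      then have "Bd t \<le> K' * (real (T - t) / real N) powr \<beta>"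
        unfolding Bd_def using K' A3 by (intro mult_left_mono powr_mono2) auto
      then have "(Bd t)\<^sup>2 \<le> (K' * (real (T - t) / real N) powr \<beta>)\<^sup>2"
        using K' by (intro power_mono) (auto simp: Bd_def)
      also have "\<dots> = K'\<^sup>2 * (real (T - t) / real N) powr (2 * \<beta>)"
        by (simp add: power_mult_distrib power2_eq_square powr_add[symmetric])
      \<comment> \<open>Distance is measured in units of the memory \<open>1 / l\<close> of the
        algorithm; the scale factor is the bias rate \<open>\<theta> N\<close>.\<close>
      also have "(real (T - t) / real N) powr (2 * \<beta>) = \<theta> N * (real (T - t) * l) powr (2 * \<beta>)"
      proof -
        have "real (T - t) / real N = (real (T - t) * l) / (real N * l)" using l by simp
        moreover have "(real (T - t) * l / (real N * l)) powr (2 * \<beta>) = (real (T - t) * l) powr (2 * \<beta>) / (real N * l) powr (2 * \<beta>)"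
          by (rule powr_divide)
        ultimately show ?thesis unfolding \<theta>_def l_def[symmetric] by simp
      qed
      also have "(real (T - t) * l) powr (2 * \<beta>) \<le> 1 + (real (T - t) * l)\<^sup>2"
        using l A3 by (intro powr_le_one_plus_square) auto
      finally have "(Bd t)\<^sup>2 \<le> K'\<^sup>2 * (\<theta> N * (1 + (real (T - t) * l)\<^sup>2))"
        using \<theta>0 by (simp add: mult_left_mono)
      moreover have "0 \<le> Bd t" using K' by (simp add: Bd_def)
      moreover have "Bd t \<le> K'"
      proof -
        have "\<bar>real (Suc t) / real N - u0\<bar> powr \<beta> \<le> 1" using tu1 u0 A3 by (intro powr_le1) auto
        then show ?thesis unfolding Bd_def using K' by (simp add: mult_left_le)
      qed
      ultimately show "0 \<le> Bd t \<and> Bd t \<le> K' \<and> 2 * (Bd t)\<^sup>2 \<le> 2 * K'\<^sup>2 * \<theta> N * (1 + (real (T - t) * l)\<^sup>2)"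
        by (simp add: mult_ac)
      fix y assume y: "y 0 = (1::real)" "\<And>i. i \<le> p \<Longrightarrow> 0 \<le> y i"
      \<comment> \<open>The times \<open>Suc t\<close> are positive here, so the convention for
        nonpositive times does not intervene.\<close>
      have ca: "coef a i (real_of_int (int (Suc t)) / real N) = a i (real (Suc t) / real N)" for i
        using tu1 by (simp add: coef_def)
      have a1: "a i (real (Suc t) / real N) \<le> A" if i: "i \<le> p" for i
      proof (cases "i = 0")
        case True
        then show ?thesis using A2(3)[OF tu1] by (simp add: A_def le_max_iff_disj)
      next
        case False
        then have "a i (real (Suc t) / real N) \<le> (\<Sum>j\<in>{1..p}. a j (real (Suc t) / real N))"
          using i a_nonneg tu1 by (intro member_le_sum) auto
        then show ?thesis using a_sum[OF tu1] A1(1) A1'(1) by linarith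
      qed
      show "step_ok p A e \<rho> (Bd t) y (\<lambda>i. coef a i (real_of_int (int (Suc t)) / real N)) (w t) (w (Suc t)) \<alpha>"
        unfolding step_ok_def ca
      proof (intro conjI allI impI ballI)
        show "\<rho> \<le> a 0 (real (Suc t) / real N)" using A2(3)[OF tu1] by (simp add: \<rho>_def min_le_iff_disj)
        show "w (Suc t) 1 = 1" by (simp add: w_def wt_def)
        show "\<bar>a i (real (Suc t) / real N) - \<alpha> i\<bar> \<le> Bd t" if "i \<le> p" for i
          unfolding Bd_def \<alpha>_def using that tu1 u0 by (intro holder)
        have diff: "\<bar>real (Suc t) / real N - real t / real N\<bar> = 1 / real N" by (simp add: diff_divide_distrib[symmetric])
        show "a i (real (Suc t) / real N) + (if i < p then w (Suc t) (Suc i) else 0) \<le> w t i - e" if "i \<in> {1..p}" for i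
          unfolding w_def using tu[of t] t tu1 that close by (intro wt_step) (auto simp: diff[simplified])
      next
        fix i assume i: "i \<in> {1..p}"
        show "0 \<le> w t i" "w t i \<le> 1" unfolding w_def using wt_range[OF tu i] t by auto
        show "0 \<le> w (Suc t) i" "w (Suc t) i \<le> 1" unfolding w_def using wt_range[OF tu1 i] by auto
      qed (use y a1 a_nonneg tu1 in auto)
    qed (use K' \<theta>0 moment[OF N] m0 pT T in \<open>auto simp: m_def\<close>)
    have "(1 - c * l) ^ (T - p) \<le> 8 / (u0 * c)\<^sup>2 * \<theta> N"
    proof -
      have Np: "0 < real N * u0 / 2" using N u0 by simp
      have cl: "0 < c * l" "c * l \<le> 1" using params params'(1) l mult_le_one[of c l] by auto
      have pos: "0 < real N * u0 / 2 * (c * l)" using Np cl(1) by (rule mult_pos_pos)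
      have le: "real N * u0 / 2 * (c * l) \<le> real (T - p) * (c * l)" using half cl by (intro mult_right_mono) auto
      have "(1 - c * l) ^ (T - p) \<le> 2 / (real (T - p) * (c * l))\<^sup>2"
        by (rule one_minus_power_le_inverse_square[OF less_imp_le[OF cl(1)] cl(2) less_le_trans[OF pos le]])
      also have "\<dots> \<le> 2 / (real N * u0 / 2 * (c * l))\<^sup>2"
        by (rule divide_left_mono[OF power_mono[OF le]]) (use pos less_le_trans[OF pos le] in \<open>simp_all only: zero_less_power mult_pos_pos less_imp_le zero_le_numeral\<close>)
      also have "\<dots> = 8 / (u0 * c)\<^sup>2 * (1 / (real N * l)\<^sup>2)"
        by (simp add: power_mult_distrib power_divide mult_ac)
      \<comment> \<open>Uses \<open>1 \<le> real N * l\<close> and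
        \<open>2 * \<beta> \<le> 2\<close>.\<close>
      also have "1 / (real N * l)\<^sup>2 \<le> \<theta> N"
      proof -
        have "(real N * l) powr (2 * \<beta>) \<le> (real N * l) powr 2" using NlN A3 by (intro powr_mono) (auto simp: l_def)
        also have "\<dots> = (real N * l)\<^sup>2" using NlN by (intro powr_numeral) (simp add: l_def)
        finally show ?thesis unfolding \<theta>_def l_def[symmetric] using l N by (intro divide_left_mono) (auto intro!: mult_pos_pos)
      qed
      finally show ?thesis using u0 params by (simp add: mult_left_mono divide_right_mono)
    qed
    then have "(1 - c * l) ^ (T - p) * (sq_norm p \<alpha> * (1 + p * m)) \<le> 8 / (u0 * c)\<^sup>2 * \<theta> N * (sq_norm p \<alpha> * (1 + p * m))"
      using sq_norm_nonneg m0 by (intro mult_right_mono) auto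
    also have "\<dots> = C2 * \<theta> N" by (simp add: C2_def)
    finally have "2 * ((1 - c * l) ^ (T - p) * (sq_norm p \<alpha> * (1 + p * m)) + l * C3 + \<theta> N * C4) \<le> 2 * (C2 * \<theta> N + l * C3 + \<theta> N * C4)"
      by simp
    also have "\<dots> \<le> C1 * (l + \<theta> N)"
    proof -
      have "0 \<le> C2 * l" "0 \<le> C3 * \<theta> N" "0 \<le> C4 * l" using C234 l \<theta>0 by simp_all
      then show ?thesis unfolding C1_def by (simp add: algebra_simps)
    qed
    finally have "2 * ((1 - c * l) ^ (T - p) * (sq_norm p \<alpha> * (1 + p * m)) + l * (L * (1 + p * m) / c) + \<theta> N * (2 * (2 * K'\<^sup>2) / c * (6 / c)\<^sup>2))
      \<le> C1 * (l + \<theta> N)"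
      unfolding C3_def C4_def .
    then have "(\<integral>\<^sup>+\<omega>. ennreal (sq_norm p (est_err l \<alpha> T \<omega>)) \<partial>M) \<le> ennreal (C1 * (l + \<theta> N))"
      using est by (meson ennreal_leI order_trans)
    then show ?thesis by (simp add: sq_norm_def est_err_def \<alpha>_def l_def T_def)
  qed
  have ev: "\<forall>\<^sub>F N in sequentially. N \<ge> 1 \<and> lam N \<le> l0 \<and> 1 \<le> real N * lam N \<and> p * (K' * (1 / real N) powr \<beta>) \<le> e \<and> 2 * (real p + 1) \<le> real N * u0"
  proof (intro eventually_conj)
    show "\<forall>\<^sub>F N in sequentially. 1 \<le> N" by (rule eventually_ge_at_top)
    show "\<forall>\<^sub>F N in sequentially. lam N \<le> l0"
      using order_tendstoD(2)[OF lam_lim l0] by (rule eventually_mono) simp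
    have "\<forall>\<^sub>F N in sequentially. norm (ln (real N) powr (1 + \<epsilon>)) \<le> 1 * norm (real N * lam N)"
      using lam_rate by (rule landau_o.smallD) simp
    then show "\<forall>\<^sub>F N in sequentially. 1 \<le> real N * lam N"
      using eventually_ge_at_top[of 3]
    proof eventually_elim
      \<comment> \<open>From \<open>N = 3\<close> on, \<open>ln N \<ge> 1\<close> because
        \<open>exp 1 \<le> 3\<close>; the rate condition then gives
        \<open>N * lam N \<ge> 1\<close>.\<close>
      case (elim N)
      have "exp 1 \<le> real N" using exp_le elim(2) by linarith
      then have "1 \<le> ln (real N)" using elim(2) by (subst ln_ge_iff) auto
      then have "1 \<le> ln (real N) powr (1 + \<epsilon>)" using eps by (intro ge_one_powr_ge_zero) auto
      then show ?case using elim(1) lam_pos[of N] by (simp add: abs_mult)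
    qed
    have "(\<lambda>N. p * (K' * (1 / real N) powr \<beta>)) \<longlonglongrightarrow> p * (K' * 0)"
      using A3(1) by (intro tendsto_mult tendsto_const) real_asymp
    then have "\<forall>\<^sub>F N in sequentially. p * (K' * (1 / real N) powr \<beta>) < e"
      using e by (intro order_tendstoD(2)) auto
    then show "\<forall>\<^sub>F N in sequentially. p * (K' * (1 / real N) powr \<beta>) \<le> e"
      by (rule eventually_mono) simp
    have "\<forall>\<^sub>F N in sequentially. 2 * (real p + 1) / u0 \<le> real N"
      using filterlim_real_sequentially by (simp add: filterlim_at_top)
    then show "\<forall>\<^sub>F N in sequentially. 2 * (real p + 1) \<le> real N * u0"
      by (rule eventually_mono) (use u0 in \<open>auto simp: field_simps\<close>)
  qed
  have meas: "(\<lambda>\<omega>. \<Sum>i\<le>p. (anre (lam N) p (\<lambda>t. X N t \<omega>) (t0 N) i - a i u0)\<^sup>2) \<in> borel_measurable M" for N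
  proof -
    have [measurable]: "(\<lambda>\<omega>. anre l p (\<lambda>t. X N t \<omega>) t i) \<in> borel_measurable M" for l t i
    proof (induction t arbitrary: i)
      case (Suc t)
      note [measurable] = Suc X_rv
      have [measurable]: "(\<lambda>\<omega>. calX p (\<lambda>t. X N t \<omega>) t i) \<in> borel_measurable M" for i
        unfolding calX_def by measurable
      show ?case by (cases "Suc t \<le> p") (simp_all add: norm1_def)
    qed simp
    show ?thesis by measurable
  qed
  have integ: "integrable M (\<lambda>\<omega>. \<Sum>i\<le>p. (anre (lam N) p (\<lambda>t. X N t \<omega>) (t0 N) i - a i u0)\<^sup>2)"
    and bound: "integral\<^sup>L M (\<lambda>\<omega>. \<Sum>i\<le>p. (anre (lam N) p (\<lambda>t. X N t \<omega>) (t0 N) i - a i u0)\<^sup>2) \<le> C1 * (lam N + \<theta> N)"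
    if N: "N \<ge> 1 \<and> lam N \<le> l0 \<and> 1 \<le> real N * lam N \<and> p * (K' * (1 / real N) powr \<beta>) \<le> e \<and> 2 * (real p + 1) \<le> real N * u0" for N
  proof -
    let ?f = "\<lambda>\<omega>. \<Sum>i\<le>p. (anre (lam N) p (\<lambda>t. X N t \<omega>) (t0 N) i - a i u0)\<^sup>2"
    have f0: "0 \<le> ?f \<omega>" for \<omega> by (intro sum_nonneg) auto
    have le: "(\<integral>\<^sup>+\<omega>. ennreal (?f \<omega>) \<partial>M) \<le> ennreal (C1 * (lam N + \<theta> N))" using main N by blast
    \<comment> \<open>The finite bound on the extended integral of a nonnegative measurable function
      already yields integrability.\<close>
    show int: "integrable M ?f"
      using le by (intro integrableI_nonneg meas AE_I2 f0) (rule le_less_trans, auto)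
    have "0 \<le> C1 * (lam N + \<theta> N)"
      unfolding C1_def \<theta>_def using C234 lam_pos[of N] by simp
    then show "integral\<^sup>L M ?f \<le> C1 * (lam N + \<theta> N)"
      using le nn_integral_eq_integral[OF int] f0 by simp
  qed
  have "(\<lambda>N. integral\<^sup>L M (\<lambda>\<omega>. \<Sum>i\<le>p. (anre (lam N) p (\<lambda>t. X N t \<omega>) (t0 N) i - a i u0)\<^sup>2))
      \<in> O(\<lambda>N. lam N + 1 / (real N * lam N) powr (2 * \<beta>))"
  proof (rule bigoI[of _ C1], rule eventually_mono[OF ev])
    fix N
    assume N: "N \<ge> 1 \<and> lam N \<le> l0 \<and> 1 \<le> real N * lam N \<and> p * (K' * (1 / real N) powr \<beta>) \<le> e \<and> 2 * (real p + 1) \<le> real N * u0"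
    have "0 \<le> lam N + \<theta> N" using lam_pos[of N] by (simp add: \<theta>_def)
    moreover have "0 \<le> integral\<^sup>L M (\<lambda>\<omega>. \<Sum>i\<le>p. (anre (lam N) p (\<lambda>t. X N t \<omega>) (t0 N) i - a i u0)\<^sup>2)"
      by (intro integral_nonneg_AE AE_I2 sum_nonneg) auto
    ultimately show "norm (integral\<^sup>L M (\<lambda>\<omega>. \<Sum>i\<le>p. (anre (lam N) p (\<lambda>t. X N t \<omega>) (t0 N) i - a i u0)\<^sup>2))
      \<le> C1 * norm (lam N + 1 / (real N * lam N) powr (2 * \<beta>))"
      using bound[OF N] by (simp add: \<theta>_def)
  qed
  moreover have "\<forall>\<^sub>F N in sequentially. integrable M (\<lambda>\<omega>. \<Sum>i\<le>p. (anre (lam N) p (\<lambda>t. X N t \<omega>) (t0 N) i - a i u0)\<^sup>2)"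
    using ev integ by (rule eventually_mono)
  ultimately show ?thesis by blast
qed

end
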